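(* Let $X$ be a finite quandle, $A$ an abelian group, $C$ a finite set of quandle $2$-cocycles with values in $A$ (representing classes in $H^2_Q(X;A)$), $k$ a coefficient ring, and $S\subset \mathrm{Hom}(X,X)$ a set of quandle endomorphisms. Let $K$ be an oriented classical or virtual knot or link represented by a diagram $D$. Then the quandle cohomology quiver representation of $D$ with respect to the data vector $(X,A,C,k,S)$ is unchanged, up to isomorphism of weighted quivers, by (classical and virtual) Reidemeister moves on $D$. Hence it is an invariant of oriented classical and virtual knots and links: if two diagrams $D,D'$ represent the same oriented classical or virtual knot or link, then their quandle cohomology quiver representations are isomorphic as weighted quivers.
   Context: **Quandles.** A quandle is a set $X$ with a binary operation $\triangleright$ such that (i) $x\triangleright x=x$ for all $x$; (ii) for every $y$ the map $x\mapsto x\triangleright y$ is invertible; (iii) $(x\triangleright y)\triangleright z=(x\triangleright z)\triangleright(y\triangleright z)$ for all $x,y,z$. $\mathrm{Hom}(X,X)$ is the set of endomorphisms, i.e. maps $\sigma:X\to X$ with $\sigma(x\triangleright y)=\sigma(x)\triangleright\sigma(y)$. **Diagrams and colorings.** Oriented virtual links are represented by oriented planar diagrams with classical and virtual crossings, up to the classical and virtual Reidemeister moves; classical links are those having diagrams with no virtual crossings, up to the classical moves. The arcs of $D$ run from classical undercrossing to classical undercrossing (passing through overcrossings and virtual crossings unchanged). An $X$-coloring of $D$ assigns an element of $X$ to each arc so that at each classical crossing, if the over-arc is colored $y$ and, with respect to the orientation of the over-arc, the under-arc on its right is colored $x$, then the under-arc on its left is colored $x\triangleright y$. The $X$-colorings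 of $D$ are identified with the elements of $\mathrm{Hom}(\mathcal{Q}(K),X)$, where $\mathcal{Q}(K)$ is the knot quandle (one generator for each arc, one relation $z=x\triangleright y$ for each classical crossing). If $\sigma\in\mathrm{Hom}(X,X)$, applying $\sigma$ to all colors of an $X$-coloring gives another $X$-coloring. **Coloring vectors.** $C_2^Q(X;\mathbb{Z})$ is the free abelian group on $X\times X$ modulo the subgroup generated by all pairs $(x,x)$. An $X$-coloring $v$ of $D$ determines $\vec v\in C_2^Q(X;\mathbb{Z})$, the sum over classical crossings of $\epsilon\,(x,y)$, where $\epsilon=\pm1$ is the crossing sign, $y$ the color of the over-arc and $x$ the color of the under-arc to the right of the over-arc. An endomorphism $\sigma$ of $X$ induces the linear map $\sigma:C_2^Q(X;\mathbb{Z})\to C_2^Q(X;\mathbb{Z})$ with $\sigma(x,y)=(\sigma(x),\sigma(y))$. **Cocycles.** A quandle $2$-cocycle with values in $A$ is a map $\phi:X\times X\to A$ with $\phi(x,x)=0$ and $\phi(x,z)-\phi(x\triangleright y,z)-\phi(x,y)+\phi(x\triangleright z,y\triangleright z)=0$ for all $x,y,z\in X$. It extends linearly to a homomorphism $C_2^Q(X;\mathbb{Z})\to A$, whose value on $\vec v$ is written $\phi(\vec v)$ or $\langle\phi,\vec v\rangle$. $H^2_Q(X;A)$ denotes second quandle cohomology (cocycles modulo coboundaries). **Quandle cohomology quiver representation.** Let $k[A]$ be the free $k$-module with basis $A$. For an $X$-coloring $v$ let $V_C(\vec v)\subset k[A]$ be the submodule generated by the basis elements $\{\phi(\vec v):\phi\in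 C\}$. For a coloring $v$, $\sigma\in S$ and $\phi\in C$, let $f_{\sigma,\phi}:k[A]\to k[A]$ be the $k$-linear map sending the basis element $\phi(\vec v)$ to the basis element $\phi(\sigma(\vec v))$ and all other basis elements to $0$; set $f_\sigma=\sum_{\phi\in C}f_{\sigma,\phi}$ (this depends on $v$). The quandle coloring quiver of $D$ with respect to $(X,S)$ is the directed multigraph whose vertices are the $X$-colorings $v$ of $D$, with one directed edge from $v$ to $\sigma(v)$ for each vertex $v$ and each $\sigma\in S$. The quandle cohomology quiver representation of $D$ with data vector $(X,A,C,k,S)$ is this quiver with each vertex $v$ weighted by the pair $(k[A],V_C(\vec v))$ and each edge $v\to\sigma(v)$ given by $\sigma\in S$ weighted by the map $f_\sigma$ associated to $v$ and $\sigma$. An isomorphism of such weighted quivers is a pair of bijections on vertices and on edges, compatible with sources and targets, preserving the weights of all vertices and edges. *)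

theory Defs
  imports
    "HOL-Library.FuncSet"
    "HOL-Algebra.Free_Abelian_Groups"
    "Graph_Theory.Digraph"
begin

section \<open>Quandles\<close>

definition quandle :: "'x set \<Rightarrow> ('x \<Rightarrow> 'x \<Rightarrow> 'x) \<Rightarrow> bool" where
  "quandle X tri \<longleftrightarrow>
     (\<forall>x\<in>X. tri x x = x) \<and>
     (\<forall>y\<in>X. bij_betw (\<lambda>x. tri x y) X X) \<and>
     (\<forall>x\<in>X. \<forall>y\<in>X. \<forall>z\<in>X. tri (tri x y) z = tri (tri x z) (tri y z))"

text \<open>Endomorphisms and cocycles are total functions that are \<open>undefined\<close> off \<open>X\<close> and
  \<open>X \<times> X\<close>, so that a set of them contains each map of the paper only once; the sum over \<open>C\<close>
  and the number of edges over \<open>S\<close> below depend on this.\<close>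

definition quandle_endomorphisms :: "'x set \<Rightarrow> ('x \<Rightarrow> 'x \<Rightarrow> 'x) \<Rightarrow> ('x \<Rightarrow> 'x) set" where
  "quandle_endomorphisms X tri =
     {\<sigma> \<in> X \<rightarrow>\<^sub>E X. \<forall>x\<in>X. \<forall>y\<in>X. \<sigma> (tri x y) = tri (\<sigma> x) (\<sigma> y)}"

definition quandle_2cocycles ::
  "'x set \<Rightarrow> ('x \<Rightarrow> 'x \<Rightarrow> 'x) \<Rightarrow> ('x \<times> 'x \<Rightarrow> 'a::ab_group_add) set" where
  "quandle_2cocycles X tri =
     {\<phi> \<in> extensional (X \<times> X).
        (\<forall>x\<in>X. \<phi> (x, x) = 0) \<and>
        (\<forall>x\<in>X. \<forall>y\<in>X. \<forall>z\<in>X.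
           \<phi> (x, z) - \<phi> (tri x y, z) - \<phi> (x, y) + \<phi> (tri x z, tri y z) = 0)}"


section \<open>The group of quandle 2-chains\<close>

definition degenerate_chains :: "'x set \<Rightarrow> ('x \<times> 'x \<Rightarrow>\<^sub>0 int) set" where
  "degenerate_chains X =
     generate (free_Abelian_group (X \<times> X)) ((\<lambda>x. frag_of (x, x)) ` X)"

definition C2Q :: "'x set \<Rightarrow> ('x \<times> 'x \<Rightarrow>\<^sub>0 int) set monoid" where
  "C2Q X = free_Abelian_group (X \<times> X) Mod degenerate_chains X"

definition C2Q_class :: "'x set \<Rightarrow> ('x \<times> 'x \<Rightarrow>\<^sub>0 int) \<Rightarrow> ('x \<times> 'x \<Rightarrow>\<^sub>0 int) set" where
  "C2Q_class X c = degenerate_chains X #>\<^bsub>free_Abelian_group (X \<times> X)\<^esub> c"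

lemma C2Q_class_in_C2Q:
  "Poly_Mapping.keys c \<subseteq> X \<times> X \<Longrightarrow> C2Q_class X c \<in> carrier (C2Q X)"
  by (simp add: C2Q_def C2Q_class_def carrier_FactGroup free_Abelian_group_def)

definition int_scale :: "int \<Rightarrow> 'a::ab_group_add \<Rightarrow> 'a" where
  "int_scale n a = (\<Sum>i<nat n. a) - (\<Sum>i<nat (- n). a)"

text \<open>Maps on \<open>C2Q X\<close> are induced by maps on the free abelian group that are constant on cosets,
  so \<open>the_elem\<close> picks the common value on the representatives.\<close>

definition cocycle_value ::
  "('x \<times> 'x \<Rightarrow> 'a::ab_group_add) \<Rightarrow> ('x \<times> 'x \<Rightarrow>\<^sub>0 int) set \<Rightarrow> 'a" where
  "cocycle_value \<phi> U =
     the_elem ((\<lambda>c. \<Sum>p\<in>Poly_Mapping.keys c. int_scale (Poly_Mapping.lookup c p) (\<phi> p)) ` U)"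

definition endo_chain ::
  "'x set \<Rightarrow> ('x \<Rightarrow> 'x) \<Rightarrow> ('x \<times> 'x \<Rightarrow>\<^sub>0 int) set \<Rightarrow> ('x \<times> 'x \<Rightarrow>\<^sub>0 int) set" where
  "endo_chain X \<sigma> U =
     the_elem ((\<lambda>c. C2Q_class X (frag_extend (\<lambda>(x, y). frag_of (\<sigma> x, \<sigma> y)) c)) ` U)"


section \<open>Oriented virtual link diagrams\<close>

text \<open>
  A planar diagram is put in general position with respect to the height function and cut along
  horizontal lines into slices, listed from bottom to top. Each slice contains exactly one of a
  local minimum (\<open>Cup\<close>), a local maximum (\<open>Cap\<close>) or a crossing, with vertical strands to its
  left and right. The strands met by a horizontal line are listed from left to right by their
  directions. Up to planar isotopy every diagram has this form, and two such lists are planar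
  isotopic iff they are related by the moves \<open>planar_isotopy\<close> below.

  In a crossing, \<open>Cross k d1 d2\<close>, the strand with direction \<open>d1\<close> goes between the bottom left
  and the top right, the strand with direction \<open>d2\<close> between the bottom right and the top left.
  The former is the over-strand if \<open>k = OverNE\<close>, the latter if \<open>k = OverNW\<close>.
  \<open>Cup d\<close> and \<open>Cap d\<close> have a left leg of direction \<open>d\<close>.
\<close>

datatype direction = Up | Down

fun opp :: "direction \<Rightarrow> direction" where
  "opp Up = Down"
| "opp Down = Up"

datatype crossing_kind = OverNE | OverNW | Virt

fun flip :: "crossing_kind \<Rightarrow> crossing_kind" where
  "flip OverNE = OverNW"
| "flip OverNW = OverNE"
| "flip Virt = Virt"

datatype tile =
    Cup direction
  | Cap direction
  | Cross crossing_kind direction direction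

fun tile_bottom :: "tile \<Rightarrow> direction list" where
  "tile_bottom (Cup d) = []"
| "tile_bottom (Cap d) = [d, opp d]"
| "tile_bottom (Cross k d1 d2) = [d1, d2]"

fun tile_top :: "tile \<Rightarrow> direction list" where
  "tile_top (Cup d) = [d, opp d]"
| "tile_top (Cap d) = []"
| "tile_top (Cross k d1 d2) = [d2, d1]"

datatype slice = Slice (left_of: "direction list") (tile_of: tile) (right_of: "direction list")

definition bottom :: "slice \<Rightarrow> direction list" where
  "bottom s = left_of s @ tile_bottom (tile_of s) @ right_of s"

definition top :: "slice \<Rightarrow> direction list" where
  "top s = left_of s @ tile_top (tile_of s) @ right_of s"

fun tangle_diagram :: "direction list \<Rightarrow> slice list \<Rightarrow> direction list \<Rightarrow> bool" where
  "tangle_diagram a [] b \<longleftrightarrow> a = b"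
| "tangle_diagram a (s # D) b \<longleftrightarrow> bottom s = a \<and> tangle_diagram (top s) D b"

definition link_diagram :: "slice list \<Rightarrow> bool" where
  "link_diagram D \<longleftrightarrow> tangle_diagram [] D []"

definition classical_crossings :: "slice list \<Rightarrow> nat set" where
  "classical_crossings D =
     {i. i < length D \<and> (\<exists>k d1 d2. tile_of (D ! i) = Cross k d1 d2 \<and> k \<noteq> Virt)}"

definition classical_diagram :: "slice list \<Rightarrow> bool" where
  "classical_diagram D \<longleftrightarrow>
     link_diagram D \<and> (\<forall>s\<in>set D. \<forall>d1 d2. tile_of s \<noteq> Cross Virt d1 d2)"


subsection \<open>Arcs\<close>

text \<open>The point \<open>(i, j)\<close> is the \<open>j\<close>-th point from the left on the bottom line of slice \<open>i\<close>.
  Two points are joined if some strand runs from one to the other inside a single slice, without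
  being the under-strand of a classical crossing there.\<close>

definition points :: "slice list \<Rightarrow> (nat \<times> nat) set" where
  "points D = {(i, j). i < length D \<and> j < length (bottom (D ! i))}"

inductive joined :: "slice list \<Rightarrow> nat \<times> nat \<Rightarrow> nat \<times> nat \<Rightarrow> bool" for D where
  left_strand:
    "\<lbrakk>i < length D; D ! i = Slice l t r; j < length l\<rbrakk> \<Longrightarrow> joined D (i, j) (Suc i, j)"
| right_strand:
    "\<lbrakk>i < length D; D ! i = Slice l t r; j < length r\<rbrakk>
     \<Longrightarrow> joined D (i, length l + length (tile_bottom t) + j)
                  (Suc i, length l + length (tile_top t) + j)"
| cup:
    "\<lbrakk>i < length D; D ! i = Slice l (Cup d) r\<rbrakk>
     \<Longrightarrow> joined D (Suc i, length l) (Suc i, length l + 1)"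
| cap:
    "\<lbrakk>i < length D; D ! i = Slice l (Cap d) r\<rbrakk>
     \<Longrightarrow> joined D (i, length l) (i, length l + 1)"
| cross_NE:
    "\<lbrakk>i < length D; D ! i = Slice l (Cross k d1 d2) r; k \<noteq> OverNW\<rbrakk>
     \<Longrightarrow> joined D (i, length l) (Suc i, length l + 1)"
| cross_NW:
    "\<lbrakk>i < length D; D ! i = Slice l (Cross k d1 d2) r; k \<noteq> OverNE\<rbrakk>
     \<Longrightarrow> joined D (i, length l + 1) (Suc i, length l)"

definition arc_at :: "slice list \<Rightarrow> nat \<times> nat \<Rightarrow> (nat \<times> nat) set" where
  "arc_at D p = {q. equivclp (joined D) p q}"

definition diagram_arcs :: "slice list \<Rightarrow> (nat \<times> nat) set set" where
  "diagram_arcs D = arc_at D ` points D"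


subsection \<open>Classical crossings\<close>

text \<open>For a classical crossing in a slice with \<open>m\<close> strands to its left: the positions, at the
  bottom (\<open>0\<close>) or top (\<open>1\<close>) of the slice, of a point of the over-strand and of the points of the
  under-strand to the right and to the left of the oriented over-strand.\<close>

fun over_pos :: "nat \<Rightarrow> tile \<Rightarrow> nat \<times> nat" where
  "over_pos m (Cross OverNE d1 d2) = (0, m)"
| "over_pos m (Cross OverNW d1 d2) = (0, m + 1)"
| "over_pos m _ = undefined"

fun right_pos :: "nat \<Rightarrow> tile \<Rightarrow> nat \<times> nat" where
  "right_pos m (Cross OverNE d1 d2) = (if d1 = Up then (0, m + 1) else (1, m))"
| "right_pos m (Cross OverNW d1 d2) = (if d2 = Up then (1, m + 1) else (0, m))"
| "right_pos m _ = undefined"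

fun left_pos :: "nat \<Rightarrow> tile \<Rightarrow> nat \<times> nat" where
  "left_pos m (Cross OverNE d1 d2) = (if d1 = Up then (1, m) else (0, m + 1))"
| "left_pos m (Cross OverNW d1 d2) = (if d2 = Up then (0, m) else (1, m + 1))"
| "left_pos m _ = undefined"

fun tile_sign :: "tile \<Rightarrow> int" where
  "tile_sign (Cross OverNE d1 d2) = (if d1 = d2 then 1 else - 1)"
| "tile_sign (Cross OverNW d1 d2) = (if d1 = d2 then - 1 else 1)"
| "tile_sign _ = 0"

definition arc_at_crossing ::
  "(nat \<Rightarrow> tile \<Rightarrow> nat \<times> nat) \<Rightarrow> slice list \<Rightarrow> nat \<Rightarrow> (nat \<times> nat) set" where
  "arc_at_crossing pos D i =
     (case pos (length (left_of (D ! i))) (tile_of (D ! i)) of (h, j) \<Rightarrow> arc_at D (i + h, j))"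

abbreviation "over_arc \<equiv> arc_at_crossing over_pos"
abbreviation "right_under_arc \<equiv> arc_at_crossing right_pos"
abbreviation "left_under_arc \<equiv> arc_at_crossing left_pos"


subsection \<open>Reidemeister moves\<close>

text \<open>The moves are stated for tangle diagrams and then applied inside link diagrams. All strand
  directions and crossing kinds are arbitrary unless restricted. Strands cross the tangles from
  bottom to top; the other positions of a move in the plane arise by planar isotopy.\<close>

inductive planar_isotopy :: "slice list \<Rightarrow> slice list \<Rightarrow> bool" where
  distant_tiles:
    "planar_isotopy
       [Slice [] t (m @ tile_bottom t'), Slice (tile_top t @ m) t' []]
       [Slice (tile_bottom t @ m) t' [], Slice [] t (m @ tile_top t')]"
| zigzag_right:
    "planar_isotopy [Slice [d] (Cup (opp d)) [], Slice [] (Cap d) [d]] []"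
| zigzag_left:
    "planar_isotopy [Slice [] (Cup d) [d], Slice [d] (Cap (opp d)) []] []"
| cup_past_strand:
    "planar_isotopy
       [Slice [] (Cup d) [e], Slice [d] (Cross k (opp d) e) []]
       [Slice [e] (Cup d) [], Slice [] (Cross (flip k) e d) [opp d]]"
| cap_past_strand:
    "planar_isotopy
       [Slice [] (Cross k d e) [opp d], Slice [e] (Cap d) []]
       [Slice [d] (Cross (flip k) e (opp d)) [], Slice [] (Cap d) [e]]"

inductive R1 :: "crossing_kind \<Rightarrow> slice list \<Rightarrow> slice list \<Rightarrow> bool" for k where
  kink_right:
    "R1 k [Slice [d] (Cup d) [], Slice [] (Cross k d d) [opp d], Slice [d] (Cap d) []] []"
| kink_left:
    "R1 k [Slice [] (Cup (opp d)) [d], Slice [opp d] (Cross k d d) [], Slice [] (Cap (opp d)) [d]] []"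

inductive R2 :: "crossing_kind \<Rightarrow> slice list \<Rightarrow> slice list \<Rightarrow> bool" for k where
  "R2 k [Slice [] (Cross k d1 d2) [], Slice [] (Cross (flip k) d2 d1) []] []"

text \<open>Strands \<open>1\<close>, \<open>2\<close>, \<open>3\<close> are numbered from left to right along the bottom; \<open>kij\<close> is the kind
  of the crossing of strands \<open>i\<close> and \<open>j\<close>, so strand \<open>i\<close> passes over strand \<open>j\<close> iff it is
  \<open>OverNE\<close>.\<close>

inductive R3 :: "crossing_kind \<Rightarrow> crossing_kind \<Rightarrow> crossing_kind \<Rightarrow> slice list \<Rightarrow> slice list \<Rightarrow> bool"
  for k12 k13 k23 where
  "R3 k12 k13 k23
     [Slice [] (Cross k12 d1 d2) [d3], Slice [d2] (Cross k13 d1 d3) [], Slice [] (Cross k23 d2 d3) [d1]]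
     [Slice [d1] (Cross k23 d2 d3) [], Slice [] (Cross k13 d1 d3) [d2], Slice [d3] (Cross k12 d1 d2) []]"

text \<open>In the classical third move one strand lies on top, one in the middle and one at the
  bottom; this excludes exactly the two cyclic choices \<open>k12 = k23 \<noteq> k13\<close>.\<close>

inductive classical_reidemeister :: "slice list \<Rightarrow> slice list \<Rightarrow> bool" where
  "k \<noteq> Virt \<Longrightarrow> R1 k T T' \<Longrightarrow> classical_reidemeister T T'"
| "k \<noteq> Virt \<Longrightarrow> R2 k T T' \<Longrightarrow> classical_reidemeister T T'"
| "\<lbrakk>Virt \<notin> {k12, k13, k23}; \<not> (k12 = k23 \<and> k13 \<noteq> k12); R3 k12 k13 k23 T T'\<rbrakk>
   \<Longrightarrow> classical_reidemeister T T'"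

text \<open>The last three rules are the mixed move, which takes a strand with two virtual crossings past
  a classical crossing.\<close>

inductive virtual_reidemeister :: "slice list \<Rightarrow> slice list \<Rightarrow> bool" where
  "R1 Virt T T' \<Longrightarrow> virtual_reidemeister T T'"
| "R2 Virt T T' \<Longrightarrow> virtual_reidemeister T T'"
| "R3 Virt Virt Virt T T' \<Longrightarrow> virtual_reidemeister T T'"
| "k \<noteq> Virt \<Longrightarrow> R3 k Virt Virt T T' \<Longrightarrow> virtual_reidemeister T T'"
| "k \<noteq> Virt \<Longrightarrow> R3 Virt k Virt T T' \<Longrightarrow> virtual_reidemeister T T'"
| "k \<noteq> Virt \<Longrightarrow> R3 Virt Virt k T T' \<Longrightarrow> virtual_reidemeister T T'"

definition pad :: "direction list \<Rightarrow> direction list \<Rightarrow> slice \<Rightarrow> slice" where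
  "pad l r s = Slice (l @ left_of s) (tile_of s) (right_of s @ r)"

definition local_move ::
  "(slice list \<Rightarrow> slice list \<Rightarrow> bool) \<Rightarrow> slice list \<Rightarrow> slice list \<Rightarrow> bool" where
  "local_move R D D' \<longleftrightarrow>
     (\<exists>below above l r T T'. (R T T' \<or> R T' T) \<and>
        D = below @ map (pad l r) T @ above \<and>
        D' = below @ map (pad l r) T' @ above)"

definition classical_move :: "slice list \<Rightarrow> slice list \<Rightarrow> bool" where
  "classical_move D D' \<longleftrightarrow>
     classical_diagram D \<and> classical_diagram D' \<and>
     local_move (\<lambda>T T'. planar_isotopy T T' \<or> classical_reidemeister T T') D D'"

definition virtual_move :: "slice list \<Rightarrow> slice list \<Rightarrow> bool" where
  "virtual_move D D' \<longleftrightarrow>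
     link_diagram D \<and> link_diagram D' \<and>
     local_move (\<lambda>T T'. planar_isotopy T T' \<or> classical_reidemeister T T' \<or>
                        virtual_reidemeister T T') D D'"

definition same_classical_link :: "slice list \<Rightarrow> slice list \<Rightarrow> bool" where
  "same_classical_link D D' \<longleftrightarrow>
     classical_diagram D \<and> classical_diagram D' \<and> classical_move\<^sup>*\<^sup>* D D'"

definition same_virtual_link :: "slice list \<Rightarrow> slice list \<Rightarrow> bool" where
  "same_virtual_link D D' \<longleftrightarrow>
     link_diagram D \<and> link_diagram D' \<and> virtual_move\<^sup>*\<^sup>* D D'"


section \<open>Colorings\<close>

definition colorings ::
  "'x set \<Rightarrow> ('x \<Rightarrow> 'x \<Rightarrow> 'x) \<Rightarrow> slice list \<Rightarrow> ((nat \<times> nat) set \<Rightarrow> 'x) set" where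
  "colorings X tri D =
     {v \<in> diagram_arcs D \<rightarrow>\<^sub>E X.
        \<forall>i\<in>classical_crossings D.
          v (left_under_arc D i) = tri (v (right_under_arc D i)) (v (over_arc D i))}"

definition push_coloring ::
  "('x \<Rightarrow> 'x) \<Rightarrow> slice list \<Rightarrow> ((nat \<times> nat) set \<Rightarrow> 'x) \<Rightarrow> (nat \<times> nat) set \<Rightarrow> 'x" where
  "push_coloring \<sigma> D v = restrict (\<sigma> \<circ> v) (diagram_arcs D)"

definition coloring_vector ::
  "'x set \<Rightarrow> slice list \<Rightarrow> ((nat \<times> nat) set \<Rightarrow> 'x) \<Rightarrow> ('x \<times> 'x \<Rightarrow>\<^sub>0 int) set" where
  "coloring_vector X D v =
     C2Q_class X
       (\<Sum>i\<in>classical_crossings D.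
          frag_cmul (tile_sign (tile_of (D ! i)))
            (frag_of (v (right_under_arc D i), v (over_arc D i))))"


section \<open>The quandle cohomology quiver representation\<close>

text \<open>The free module \<open>k[A]\<close> is the type \<open>'a \<Rightarrow>\<^sub>0 'k\<close> with basis \<open>Poly_Mapping.single a 1\<close>.
  The library's modules are over commutative rings only, hence the next definition.\<close>

definition left_submodule :: "('a \<Rightarrow>\<^sub>0 'k::ring_1) set \<Rightarrow> bool" where
  "left_submodule M \<longleftrightarrow>
     0 \<in> M \<and> (\<forall>x\<in>M. \<forall>y\<in>M. x + y \<in> M) \<and> (\<forall>c. \<forall>x\<in>M. Poly_Mapping.map ((*) c) x \<in> M)"

definition vertex_module ::
  "('x \<times> 'x \<Rightarrow> 'a::ab_group_add) set \<Rightarrow> ('x \<times> 'x \<Rightarrow>\<^sub>0 int) set \<Rightarrow> ('a \<Rightarrow>\<^sub>0 'k::ring_1) set" where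
  "vertex_module C U = left_submodule hull {Poly_Mapping.single (cocycle_value \<phi> U) 1 | \<phi>. \<phi> \<in> C}"

definition edge_map_part ::
  "'x set \<Rightarrow> ('x \<times> 'x \<Rightarrow>\<^sub>0 int) set \<Rightarrow> ('x \<Rightarrow> 'x) \<Rightarrow> ('x \<times> 'x \<Rightarrow> 'a::ab_group_add)
     \<Rightarrow> ('a \<Rightarrow>\<^sub>0 'k::ring_1) \<Rightarrow> ('a \<Rightarrow>\<^sub>0 'k)" where
  "edge_map_part X U \<sigma> \<phi> w =
     Poly_Mapping.single (cocycle_value \<phi> (endo_chain X \<sigma> U))
       (Poly_Mapping.lookup w (cocycle_value \<phi> U))"

definition edge_map ::
  "'x set \<Rightarrow> ('x \<times> 'x \<Rightarrow> 'a::ab_group_add) set \<Rightarrow> ('x \<times> 'x \<Rightarrow>\<^sub>0 int) set \<Rightarrow> ('x \<Rightarrow> 'x)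
     \<Rightarrow> ('a \<Rightarrow>\<^sub>0 'k::ring_1) \<Rightarrow> ('a \<Rightarrow>\<^sub>0 'k)" where
  "edge_map X C U \<sigma> w = (\<Sum>\<phi>\<in>C. edge_map_part X U \<sigma> \<phi> w)"

record ('v, 'e, 'p, 'm) weighted_quiver = "('v, 'e) pre_digraph" +
  vertex_weight :: "'v \<Rightarrow> 'p"
  edge_weight :: "'e \<Rightarrow> 'm"

definition quiver_isomorphic ::
  "('v, 'e, 'p, 'm) weighted_quiver \<Rightarrow> ('w, 'f, 'p, 'm) weighted_quiver \<Rightarrow> bool" where
  "quiver_isomorphic G H \<longleftrightarrow>
     (\<exists>f g. bij_betw f (verts G) (verts H) \<and> bij_betw g (arcs G) (arcs H) \<and>
        (\<forall>e\<in>arcs G. tail H (g e) = f (tail G e) \<and> head H (g e) = f (head G e)) \<and>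
        (\<forall>v\<in>verts G. vertex_weight H (f v) = vertex_weight G v) \<and>
        (\<forall>e\<in>arcs G. edge_weight H (g e) = edge_weight G e))"

definition quiver_representation ::
  "'x set \<Rightarrow> ('x \<Rightarrow> 'x \<Rightarrow> 'x) \<Rightarrow> ('x \<times> 'x \<Rightarrow> 'a::ab_group_add) set \<Rightarrow> 'k::ring_1 itself
     \<Rightarrow> ('x \<Rightarrow> 'x) set \<Rightarrow> slice list
     \<Rightarrow> ((nat \<times> nat) set \<Rightarrow> 'x, ((nat \<times> nat) set \<Rightarrow> 'x) \<times> ('x \<Rightarrow> 'x),
         ('a \<Rightarrow>\<^sub>0 'k) set \<times> ('a \<Rightarrow>\<^sub>0 'k) set, ('a \<Rightarrow>\<^sub>0 'k) \<Rightarrow> ('a \<Rightarrow>\<^sub>0 'k)) weighted_quiver" where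
  "quiver_representation X tri C _ S D =
     \<lparr> verts = colorings X tri D,
       arcs = colorings X tri D \<times> S,
       tail = fst,
       head = (\<lambda>(v, \<sigma>). push_coloring \<sigma> D v),
       vertex_weight = (\<lambda>v. (UNIV, vertex_module C (coloring_vector X D v))),
       edge_weight = (\<lambda>(v, \<sigma>). edge_map X C (coloring_vector X D v) \<sigma>) \<rparr>"

end

theory Submission
  imports Defs
begin

text \<open>
  A coloring of a link diagram is determined by the colors that it puts on the horizontal lines
  between the slices, read from left to right. A list of color rows arises in this way iff it
  satisfies one condition per slice (\<open>rows_bij\<close>), so colorings become paths, here called traces,
  that can be cut below and above a move. The bijection between the colorings of two diagrams
  related by a move keeps all rows outside the move and changes those inside. It exists
  because, for each of the moves, the colors on the boundary determine the interior colors on both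
  sides, and the same boundary colors occur on both sides (\<open>local_equiv_move\<close>). This
  characterization by the boundary also makes the bijection commute with every endomorphism, since
  an endomorphism maps traces to traces (\<open>link_traces_bij\<close>).

  The bijection need not preserve the coloring vectors themselves: the third Reidemeister move
  changes them by a boundary. The weights of the quiver, however, see a
  coloring vector only through the values of the cocycles in \<open>C\<close> on it and on its images under
  endomorphisms. The image of the vector of \<open>v\<close> under \<open>\<sigma>\<close> is the vector of the pushed coloring
  (\<open>endo_chain_coloring_vector\<close>), so it suffices that the cocycle values of corresponding
  colorings agree. These values are sums over the slices (\<open>cocycle_value_coloring_vector\<close>), hence
  only the slices of the move matter, and there the third move is the cocycle condition.

  All orientations and all classical third moves are treated at once. A strand that passes from one
  side to the other below a strand of color \<open>y\<close> changes its color by the action of \<open>y\<close> or by the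
  inverse action, depending on the side from which it comes, and the quandle axioms and the cocycle
  condition extend to all choices of these signs (\<open>pass_distrib\<close>, \<open>pass_weight_cocycle\<close>).
\<close>

section \<open>Passing under a strand\<close>

locale quandle_with_cocycles =
  fixes X :: "'x set" and tri :: "'x \<Rightarrow> 'x \<Rightarrow> 'x"
    and C :: "('x \<times> 'x \<Rightarrow> 'a::ab_group_add) set"
  assumes quandle: "quandle X tri"
    and cocycles: "C \<subseteq> quandle_2cocycles X tri"
begin

text \<open>The color of a strand of color \<open>x\<close> after passing below a strand of color \<open>y\<close>: \<open>Up\<close> stands for
  the passage from the right to the left of the oriented over-strand, \<open>Down\<close> for the reverse one.\<close>

definition pass :: "direction \<Rightarrow> 'x \<Rightarrow> 'x \<Rightarrow> 'x" where
  "pass d y x = (case d of Up \<Rightarrow> tri x y | Down \<Rightarrow> the_inv_into X (\<lambda>x. tri x y) x)"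

text \<open>The signed cocycle value of the crossing in such a passage when the under-strand is oriented along
  the passage. From left to right the crossing is negative, and the color to the right of the
  over-strand is the final one.\<close>

definition pass_weight :: "('x \<times> 'x \<Rightarrow> 'a) \<Rightarrow> direction \<Rightarrow> 'x \<Rightarrow> 'x \<Rightarrow> 'a" where
  "pass_weight \<phi> d y x = (case d of Up \<Rightarrow> \<phi> (x, y) | Down \<Rightarrow> - \<phi> (pass Down y x, y))"

lemma tri_closed: "x \<in> X \<Longrightarrow> y \<in> X \<Longrightarrow> tri x y \<in> X"
  using quandle by (auto simp: quandle_def dest: bij_betwE)

lemma tri_inj: "y \<in> X \<Longrightarrow> inj_on (\<lambda>x. tri x y) X"
  using quandle by (auto simp: quandle_def bij_betw_def)

lemma pass_closed [simp]: "x \<in> X \<Longrightarrow> y \<in> X \<Longrightarrow> pass d y x \<in> X"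
proof (cases d)
  case Down
  assume *: "x \<in> X" "y \<in> X"
  then have "bij_betw (\<lambda>x. tri x y) X X"
    using quandle by (simp add: quandle_def)
  then show ?thesis
    using the_inv_into_into[of "\<lambda>x. tri x y" X x X] * Down
    by (auto simp: pass_def bij_betw_def)
qed (simp add: pass_def tri_closed)

lemma tri_pass_Down: "x \<in> X \<Longrightarrow> y \<in> X \<Longrightarrow> tri (pass Down y x) y = x"
  using quandle f_the_inv_into_f[of "\<lambda>x. tri x y" X x]
  by (auto simp: pass_def quandle_def bij_betw_def)

lemma pass_Down_tri: "x \<in> X \<Longrightarrow> y \<in> X \<Longrightarrow> pass Down y (tri x y) = x"
  using the_inv_into_f_f[OF tri_inj] by (simp add: pass_def)

lemma opp_opp [simp]: "opp (opp d) = d"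
  by (cases d) auto

lemma pass_opp_pass [simp]: "x \<in> X \<Longrightarrow> y \<in> X \<Longrightarrow> pass (opp d) y (pass d y x) = x"
  using tri_pass_Down[of x y] pass_Down_tri[of x y] by (cases d) (auto simp: pass_def)

lemma pass_pass_opp [simp]: "x \<in> X \<Longrightarrow> y \<in> X \<Longrightarrow> pass d y (pass (opp d) y x) = x"
  using pass_opp_pass[of x y "opp d"] by simp

lemma pass_inj:
  "\<lbrakk>pass d y x = pass d y x'; x \<in> X; x' \<in> X; y \<in> X\<rbrakk> \<Longrightarrow> x = x'"
  by (metis pass_opp_pass)

lemma pass_self [simp]: "x \<in> X \<Longrightarrow> pass d x x = x"
proof (cases d)
  case Up
  assume "x \<in> X"
  then show ?thesis using quandle Up by (simp add: quandle_def pass_def)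
next
  case Down
  assume x: "x \<in> X"
  then have "tri x x = x" using quandle by (simp add: quandle_def)
  then show ?thesis using pass_Down_tri[OF x x] Down by simp
qed

lemma pass_self_iff: "\<lbrakk>x \<in> X; y \<in> X\<rbrakk> \<Longrightarrow> pass d y x = y \<longleftrightarrow> x = y"
  using pass_inj[of d y x y] by auto

text \<open>The action of each color and its inverse are automorphisms, so self-distributivity holds for every
  combination of signs.\<close>

lemma pass_distrib:
  assumes "x \<in> X" "y \<in> X" "z \<in> X"
  shows "pass e z (pass d y x) = pass d (pass e z y) (pass e z x)"
proof -
  have UU: "pass Up z (pass Up y x) = pass Up (pass Up z y) (pass Up z x)"
    if "x \<in> X" "y \<in> X" "z \<in> X" for x y z
    using that quandle unfolding pass_def quandle_def direction.case by blast
  have UD: "pass Up z (pass Down y x) = pass Down (pass Up z y) (pass Up z x)"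
    if "x \<in> X" "y \<in> X" "z \<in> X" for x y z
  proof -
    have "pass Up z x = pass Up (pass Up z y) (pass Up z (pass Down y x))"
      using UU[of "pass Down y x" y z] pass_pass_opp[of x y Up] that by simp
    then show ?thesis
      using pass_opp_pass[of "pass Up z (pass Down y x)" "pass Up z y" Up] that by simp
  qed
  have U: "pass Up z (pass d y x) = pass d (pass Up z y) (pass Up z x)"
    if "x \<in> X" "y \<in> X" "z \<in> X" for x y z d
    using UU[OF that] UD[OF that] by (cases d) (simp_all only:)
  show ?thesis
  proof (cases e)
    case Up
    then show ?thesis using U assms by simp
  next
    case Down
    have "pass Up z (pass d (pass Down z y) (pass Down z x)) = pass d y x"
      using U[of "pass Down z x" "pass Down z y" z d] pass_pass_opp[of _ z Up] assms by simp
    then show ?thesis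
      using pass_opp_pass[of "pass d (pass Down z y) (pass Down z x)" z Up] assms Down by simp
  qed
qed

lemma pass_weight_self [simp]: "\<phi> \<in> C \<Longrightarrow> x \<in> X \<Longrightarrow> pass_weight \<phi> d x x = 0"
  using cocycles by (cases d) (auto simp: pass_weight_def quandle_2cocycles_def)

lemma pass_weight_opp:
  "\<lbrakk>x \<in> X; y \<in> X\<rbrakk> \<Longrightarrow> pass_weight \<phi> (opp d) y (pass d y x) = - pass_weight \<phi> d y x"
  using pass_opp_pass[of x y d] by (cases d) (auto simp: pass_weight_def)

text \<open>Both sides are the total weight of a strand of color \<open>x\<close> that passes below two crossing strands,
  which it meets in either order. For two passages \<open>Up\<close> this is the cocycle condition.\<close>

lemma pass_weight_cocycle:
  assumes "\<phi> \<in> C" "x \<in> X" "y \<in> X" "z \<in> X"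
  shows "pass_weight \<phi> e z x + pass_weight \<phi> d (pass e z y) (pass e z x) =
         pass_weight \<phi> d y x + pass_weight \<phi> e z (pass d y x)" (is "?P e d x y z")
proof -
  have UU: "?P Up Up x y z" if "x \<in> X" "y \<in> X" "z \<in> X" for x y z
  proof -
    have "\<phi> (x, z) - \<phi> (tri x y, z) - \<phi> (x, y) + \<phi> (tri x z, tri y z) = 0"
      using that assms(1) cocycles by (auto simp: quandle_2cocycles_def)
    then show ?thesis
      by (simp add: pass_weight_def pass_def algebra_simps eq_neg_iff_add_eq_0)
  qed
  \<comment> \<open>At the color before a reversed passage, the law for \<open>Up\<close> becomes the law for \<open>Down\<close>: the reversal
      negates the weight of the passage and moves it to the other side.\<close>
  have UD: "?P Up Down x y z" if "x \<in> X" "y \<in> X" "z \<in> X" for x y z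
  proof -
    let ?x = "pass Down y x"
    have "pass_weight \<phi> Down y x = - pass_weight \<phi> Up y ?x"
         "pass_weight \<phi> Down (pass Up z y) (pass Up z x) =
          - pass_weight \<phi> Up (pass Up z y) (pass Up z ?x)"
      using pass_weight_opp[of ?x y \<phi> Up]
        pass_weight_opp[of "pass Up z ?x" "pass Up z y" \<phi> Up]
        pass_distrib[of ?x y z Up Up] pass_pass_opp[of x y Up] that by simp_all
    then show ?thesis
      using UU[of ?x y z] pass_pass_opp[of x y Up] that by (simp add: algebra_simps)
  qed
  have U: "?P Up d x y z" if "x \<in> X" "y \<in> X" "z \<in> X" for x y z
    using UU[OF that] UD[OF that] by (cases d) (simp_all only:)
  show ?thesis
  proof (cases e)
    case Up
    then show ?thesis using U assms by simp
  next
    case Down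
    let ?x = "pass Down z x" and ?y = "pass Down z y"
    have "pass_weight \<phi> Down z x = - pass_weight \<phi> Up z ?x"
         "pass_weight \<phi> Down z (pass d y x) = - pass_weight \<phi> Up z (pass d ?y ?x)"
      using pass_weight_opp[of ?x z \<phi> Up]
        pass_weight_opp[of "pass d ?y ?x" z \<phi> Up]
        pass_distrib[of ?x ?y z Up d] pass_pass_opp[of x z Up] pass_pass_opp[of y z Up] assms
      by simp_all
    then show ?thesis
      using U[of ?x ?y z] pass_pass_opp[of x z Up] pass_pass_opp[of y z Up] assms Down
      by (simp add: algebra_simps)
  qed
qed

text \<open>Read from left to right, this and the next lemma replace a composite over-color by simple ones.
  After rewriting, transported colors are words in simple over-colors, compared by
  cancelling inverse letters; the weights become sums along such words.\<close>

lemma pass_conj: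
  assumes "x \<in> X" "y \<in> X" "z \<in> X"
  shows "pass d (pass e z y) x = pass e z (pass d y (pass (opp e) z x))"
  using pass_distrib[of "pass (opp e) z x" y z e d] assms by simp

lemma pass_weight_conj:
  assumes "\<phi> \<in> C" "x \<in> X" "y \<in> X" "z \<in> X"
  shows "pass_weight \<phi> d (pass e z y) x =
         pass_weight \<phi> (opp e) z x + pass_weight \<phi> d y (pass (opp e) z x)
         + pass_weight \<phi> e z (pass d y (pass (opp e) z x))"
  using pass_weight_cocycle[of \<phi> "pass (opp e) z x" y z e d]
    pass_weight_opp[of x z \<phi> "opp e"] assms by (simp add: algebra_simps)

lemma pass_weight_opp':
  "\<lbrakk>x \<in> X; y \<in> X\<rbrakk> \<Longrightarrow> pass_weight \<phi> d y (pass (opp d) y x) = - pass_weight \<phi> (opp d) y x"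
  using pass_weight_opp[of x y \<phi> "opp d"] by simp

section \<open>Colors along the horizontal lines of a tangle\<close>

fun signed :: "direction \<Rightarrow> 'a \<Rightarrow> 'a" where
  "signed Up a = a"
| "signed Down a = - a"

text \<open>The colors at the top left and the top right of a crossing with bottom colors \<open>x\<close> and \<open>y\<close>. An
  under-strand that goes up the page comes from the right of an upward over-strand of kind
  \<open>OverNE\<close> but from the left of one of kind \<open>OverNW\<close>, hence \<open>opp\<close> in the latter case.\<close>

fun cross_left :: "crossing_kind \<Rightarrow> direction \<Rightarrow> 'x \<Rightarrow> 'x \<Rightarrow> 'x" where
  "cross_left OverNE d1 x y = pass d1 x y"
| "cross_left OverNW d1 x y = y"
| "cross_left Virt d1 x y = y"

fun cross_right :: "crossing_kind \<Rightarrow> direction \<Rightarrow> 'x \<Rightarrow> 'x \<Rightarrow> 'x" where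
  "cross_right OverNE d2 x y = x"
| "cross_right OverNW d2 x y = pass (opp d2) y x"
| "cross_right Virt d2 x y = x"

fun tile_rel :: "tile \<Rightarrow> 'x list \<Rightarrow> 'x list \<Rightarrow> bool" where
  "tile_rel (Cup d) bs ts \<longleftrightarrow> bs = [] \<and> (\<exists>x. ts = [x, x])"
| "tile_rel (Cap d) bs ts \<longleftrightarrow> (\<exists>x. bs = [x, x]) \<and> ts = []"
| "tile_rel (Cross k d1 d2) bs ts \<longleftrightarrow>
     (\<exists>x y. bs = [x, y] \<and> ts = [cross_left k d1 x y, cross_right k d2 x y])"

text \<open>The weight of a passage up the page, with the opposite sign if the under-strand is directed down.\<close>

fun tile_weight :: "('x \<times> 'x \<Rightarrow> 'a) \<Rightarrow> tile \<Rightarrow> 'x list \<Rightarrow> 'a" where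
  "tile_weight \<phi> (Cross OverNE d1 d2) [x, y] = signed d2 (pass_weight \<phi> d1 x y)"
| "tile_weight \<phi> (Cross OverNW d1 d2) [x, y] = signed d1 (pass_weight \<phi> (opp d2) y x)"
| "tile_weight \<phi> _ _ = 0"

definition slice_rel :: "slice \<Rightarrow> 'x list \<Rightarrow> 'x list \<Rightarrow> bool" where
  "slice_rel s xs ys \<longleftrightarrow> set xs \<subseteq> X \<and> set ys \<subseteq> X \<and>
     (\<exists>ls bs ts rs. xs = ls @ bs @ rs \<and> ys = ls @ ts @ rs \<and> tile_rel (tile_of s) bs ts \<and>
        length ls = length (left_of s) \<and> length rs = length (right_of s))"

text \<open>The colors at the bottom of a tile determine those at its top where the weight depends on them, so
  the row \<open>xs\<close> below the slice suffices.\<close>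

definition slice_weight :: "('x \<times> 'x \<Rightarrow> 'a) \<Rightarrow> slice \<Rightarrow> 'x list \<Rightarrow> 'a" where
  "slice_weight \<phi> s xs =
     tile_weight \<phi> (tile_of s)
       (take (length (tile_bottom (tile_of s))) (drop (length (left_of s)) xs))"

text \<open>In \<open>trace xs T css ys\<close> the row \<open>xs\<close> lies below the tangle, and \<open>css\<close> contains the rows above each of
  its slices, the last of which is \<open>ys\<close>.\<close>

fun trace :: "'x list \<Rightarrow> slice list \<Rightarrow> 'x list list \<Rightarrow> 'x list \<Rightarrow> bool" where
  "trace xs [] css ys \<longleftrightarrow> css = [] \<and> xs = ys"
| "trace xs (s # T) css ys \<longleftrightarrow> (\<exists>zs css'. css = zs # css' \<and> slice_rel s xs zs \<and> trace zs T css' ys)"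

fun trace_weight :: "('x \<times> 'x \<Rightarrow> 'a) \<Rightarrow> 'x list \<Rightarrow> slice list \<Rightarrow> 'x list list \<Rightarrow> 'a" where
  "trace_weight \<phi> xs [] css = 0"
| "trace_weight \<phi> xs (s # T) css = slice_weight \<phi> s xs + trace_weight \<phi> (hd css) T (tl css)"

lemma tile_rel_length:
  "tile_rel t bs ts \<Longrightarrow> length bs = length (tile_bottom t) \<and> length ts = length (tile_top t)"
  by (cases t) auto

lemma slice_rel_length:
  "slice_rel s xs ys \<Longrightarrow> length xs = length (bottom s) \<and> length ys = length (top s)"
  by (auto simp: slice_rel_def bottom_def top_def dest!: tile_rel_length)

lemma slice_rel_set: "slice_rel s xs ys \<Longrightarrow> set xs \<subseteq> X \<and> set ys \<subseteq> X"
  by (auto simp: slice_rel_def)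

text \<open>Vertical strands to the left and the right keep their colors, so padding a slice changes neither its
  condition nor its weight.\<close>

lemma slice_rel_pad:
  assumes "length ls = length l" "length rs = length r" "set ls \<subseteq> X" "set rs \<subseteq> X"
  shows "slice_rel (pad l r s) (ls @ xs @ rs) c \<longleftrightarrow> (\<exists>ys. c = ls @ ys @ rs \<and> slice_rel s xs ys)"
proof
  assume "slice_rel (pad l r s) (ls @ xs @ rs) c"
  then obtain ls' bs ts rs' where *: "ls @ xs @ rs = ls' @ bs @ rs'" "c = ls' @ ts @ rs'"
      "tile_rel (tile_of s) bs ts" "length ls' = length l + length (left_of s)"
      "length rs' = length (right_of s) + length r" "set (ls @ xs @ rs) \<subseteq> X" "set c \<subseteq> X"
    unfolding slice_rel_def pad_def slice.sel length_append by (elim conjE exE) blast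
  define l2 r1 where "l2 = drop (length l) ls'" and "r1 = take (length (right_of s)) rs'"
  have ls': "ls' = ls @ l2"
    using arg_cong[OF *(1), of "take (length l)"] *(4) assms(1)
    by (simp add: l2_def)
  have "rev rs @ rev xs @ rev ls = rev rs' @ rev bs @ rev ls'"
    using arg_cong[OF *(1), of rev] by simp
  from arg_cong[OF this, of "take (length r)"] *(5) assms(2)
  have "rev rs = take (length r) (rev rs')" by simp
  then have "rs = drop (length (right_of s)) rs'"
    using *(5) assms(2) by (simp add: take_rev)
  then have rs': "rs' = r1 @ rs" by (simp add: r1_def)
  have "xs = l2 @ bs @ r1" using *(1) ls' rs' by simp
  moreover have "length l2 = length (left_of s)" "length r1 = length (right_of s)"
    using *(4,5) by (auto simp: l2_def r1_def)
  ultimately have "slice_rel s xs (l2 @ ts @ r1)"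
    using *(2,3,6,7) ls' rs' unfolding slice_rel_def by auto
  then show "\<exists>ys. c = ls @ ys @ rs \<and> slice_rel s xs ys"
    using *(2) ls' rs' by auto
next
  assume "\<exists>ys. c = ls @ ys @ rs \<and> slice_rel s xs ys"
  then obtain ys l2 bs ts r1 where *: "c = ls @ ys @ rs" "set xs \<subseteq> X" "set ys \<subseteq> X"
    "xs = l2 @ bs @ r1" "ys = l2 @ ts @ r1" "tile_rel (tile_of s) bs ts"
    "length l2 = length (left_of s)" "length r1 = length (right_of s)"
    unfolding slice_rel_def by auto
  show "slice_rel (pad l r s) (ls @ xs @ rs) c"
    unfolding slice_rel_def
    by (rule conjI, use * assms in simp, rule conjI, use * assms in simp,
        rule exI[of _ "ls @ l2"], rule exI[of _ bs], rule exI[of _ ts], rule exI[of _ "r1 @ rs"])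
       (use * assms in \<open>simp add: pad_def\<close>)
qed

lemma slice_weight_pad:
  assumes "length ls = length l" "length xs = length (bottom s)"
  shows "slice_weight \<phi> (pad l r s) (ls @ xs @ rs) = slice_weight \<phi> s xs"
  using assms by (simp add: slice_weight_def pad_def bottom_def)

lemma trace_append:
  "trace xs (T @ U) css ys \<longleftrightarrow>
   (\<exists>c1 c2 zs. css = c1 @ c2 \<and> trace xs T c1 zs \<and> trace zs U c2 ys)"
proof (induction T arbitrary: xs css)
  case (Cons s T)
  show ?case
  proof
    assume "trace xs ((s # T) @ U) css ys"
    then obtain zs css' where "css = zs # css'" "slice_rel s xs zs" "trace zs (T @ U) css' ys"
      by auto
    moreover from this Cons.IH obtain c1 c2 ws where
      "css' = c1 @ c2" "trace zs T c1 ws" "trace ws U c2 ys" by blast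
    ultimately show "\<exists>c1 c2 ws. css = c1 @ c2 \<and> trace xs (s # T) c1 ws \<and> trace ws U c2 ys"
      by (intro exI[of _ "zs # c1"] exI[of _ c2] exI[of _ ws]) auto
  next
    assume "\<exists>c1 c2 ws. css = c1 @ c2 \<and> trace xs (s # T) c1 ws \<and> trace ws U c2 ys"
    then show "trace xs ((s # T) @ U) css ys"
      using Cons.IH by fastforce
  qed
qed auto

lemma trace_length: "trace xs T css ys \<Longrightarrow> length css = length T"
  by (induction T arbitrary: xs css) auto

lemma trace_end: "trace xs T css ys \<Longrightarrow> ys = last (xs # css)"
  by (induction T arbitrary: xs css) auto

lemma trace_set: "trace xs T css ys \<Longrightarrow> set xs \<subseteq> X \<Longrightarrow> set ys \<subseteq> X"
  by (induction T arbitrary: xs css) (auto dest!: slice_rel_set)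

lemma trace_weight_append:
  "trace xs T c1 zs \<Longrightarrow>
   trace_weight \<phi> xs (T @ U) (c1 @ c2) = trace_weight \<phi> xs T c1 + trace_weight \<phi> zs U c2"
  by (induction T arbitrary: xs c1) (auto simp: add.assoc)

lemma trace_tangle_length:
  "\<lbrakk>tangle_diagram a T b; trace xs T css ys; length xs = length a\<rbrakk> \<Longrightarrow> length ys = length b"
  by (induction T arbitrary: a xs css) (auto dest!: slice_rel_length)

lemma trace_pad:
  assumes "length ls = length l" "length rs = length r" "set ls \<subseteq> X" "set rs \<subseteq> X"
  shows "trace (ls @ xs @ rs) (map (pad l r) T) css us \<longleftrightarrow>
    (\<exists>p ys. css = map (\<lambda>c. ls @ c @ rs) p \<and> us = ls @ ys @ rs \<and> trace xs T p ys)"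
proof (induction T arbitrary: xs css)
  case (Cons s T)
  show ?case
  proof
    assume "trace (ls @ xs @ rs) (map (pad l r) (s # T)) css us"
    then obtain zs css' where "css = (ls @ zs @ rs) # css'" "slice_rel s xs zs"
        "trace (ls @ zs @ rs) (map (pad l r) T) css' us"
      using slice_rel_pad[OF assms] by auto
    moreover from this Cons.IH obtain p ys where
      "css' = map (\<lambda>c. ls @ c @ rs) p" "us = ls @ ys @ rs" "trace zs T p ys" by blast
    ultimately show "\<exists>p ys. css = map (\<lambda>c. ls @ c @ rs) p \<and> us = ls @ ys @ rs \<and> trace xs (s # T) p ys"
      by (intro exI[of _ "zs # p"] exI[of _ ys]) auto
  next
    assume "\<exists>p ys. css = map (\<lambda>c. ls @ c @ rs) p \<and> us = ls @ ys @ rs \<and> trace xs (s # T) p ys"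
    then obtain zs p ys where *: "css = (ls @ zs @ rs) # map (\<lambda>c. ls @ c @ rs) p"
        "us = ls @ ys @ rs" "slice_rel s xs zs" "trace zs T p ys" by auto
    have "slice_rel (pad l r s) (ls @ xs @ rs) (ls @ zs @ rs)"
      using slice_rel_pad[OF assms] *(3) by blast
    moreover have "trace (ls @ zs @ rs) (map (pad l r) T) (map (\<lambda>c. ls @ c @ rs) p) us"
      using Cons.IH *(2,4) by blast
    ultimately show "trace (ls @ xs @ rs) (map (pad l r) (s # T)) css us"
      using *(1) by simp
  qed
qed auto

lemma trace_weight_pad:
  assumes "length ls = length l"
  shows "trace xs T p ys \<Longrightarrow>
    trace_weight \<phi> (ls @ xs @ rs) (map (pad l r) T) (map (\<lambda>c. ls @ c @ rs) p) =
    trace_weight \<phi> xs T p"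
proof (induction T arbitrary: xs p)
  case (Cons s T)
  then obtain zs p' where "p = zs # p'" "slice_rel s xs zs" "trace zs T p' ys" by auto
  then show ?case
    using Cons.IH[of zs p'] slice_weight_pad[of ls l xs s \<phi> r rs] assms slice_rel_length[of s xs zs]
    by simp
qed simp

text \<open>This is what a replacement of \<open>T\<close> by \<open>T'\<close> has to satisfy: on both sides the interior colors are
  determined by the boundary colors \<open>xs\<close> and \<open>ys\<close>, both sides admit the same boundary colors, and then have
  the same weight. As the empty tangle fits any directions, one side has to be nonempty in order
  to fix the directions \<open>a\<close>.\<close>

definition local_equiv :: "slice list \<Rightarrow> slice list \<Rightarrow> bool" where
  "local_equiv T T' \<longleftrightarrow> (T \<noteq> [] \<or> T' \<noteq> []) \<and>
     (\<exists>a b. tangle_diagram a T b \<and> tangle_diagram a T' b \<and>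
       (\<forall>xs ys. set xs \<subseteq> X \<longrightarrow> length xs = length a \<longrightarrow>
          (\<exists>\<^sub>\<le>\<^sub>1 p. trace xs T p ys) \<and> (\<exists>\<^sub>\<le>\<^sub>1 p. trace xs T' p ys) \<and>
          ((\<exists>p. trace xs T p ys) \<longleftrightarrow> (\<exists>p. trace xs T' p ys)) \<and>
          (\<forall>p p'. trace xs T p ys \<longrightarrow> trace xs T' p' ys \<longrightarrow>
             (\<forall>\<phi>\<in>C. trace_weight \<phi> xs T p = trace_weight \<phi> xs T' p'))))"

lemma local_equiv_sym:
  assumes "local_equiv T T'"
  shows "local_equiv T' T"
proof -
  from assms obtain a b where *: "T \<noteq> [] \<or> T' \<noteq> []"
    "tangle_diagram a T b" "tangle_diagram a T' b" and
    **: "\<And>xs ys. \<lbrakk>set xs \<subseteq> X; length xs = length a\<rbrakk> \<Longrightarrow>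
          (\<exists>\<^sub>\<le>\<^sub>1 p. trace xs T p ys) \<and> (\<exists>\<^sub>\<le>\<^sub>1 p. trace xs T' p ys) \<and>
          ((\<exists>p. trace xs T p ys) \<longleftrightarrow> (\<exists>p. trace xs T' p ys)) \<and>
          (\<forall>p p'. trace xs T p ys \<longrightarrow> trace xs T' p' ys \<longrightarrow>
             (\<forall>\<phi>\<in>C. trace_weight \<phi> xs T p = trace_weight \<phi> xs T' p'))"
    unfolding local_equiv_def by blast
  show ?thesis
    unfolding local_equiv_def
  proof (rule conjI, use *(1) in blast, rule exI[of _ a], rule exI[of _ b],
      intro conjI allI impI ballI)
    fix xs ys :: "'x list" and p p' \<phi>
    assume xs: "set xs \<subseteq> X" "length xs = length a"
    show "\<exists>\<^sub>\<le>\<^sub>1 p. trace xs T' p ys" "\<exists>\<^sub>\<le>\<^sub>1 p. trace xs T p ys"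
      "(\<exists>p. trace xs T' p ys) \<longleftrightarrow> (\<exists>p. trace xs T p ys)"
      using **[OF xs] by blast+
    assume "trace xs T' p ys" "trace xs T p' ys" "\<phi> \<in> C"
    then show "trace_weight \<phi> xs T' p = trace_weight \<phi> xs T p'"
      using **[OF xs, of ys] by simp
  qed (use * in blast)+
qed

section \<open>Traces of the local moves\<close>

lemma cross_closed [simp]:
  "\<lbrakk>x \<in> X; y \<in> X\<rbrakk> \<Longrightarrow> cross_left k d x y \<in> X"
  "\<lbrakk>x \<in> X; y \<in> X\<rbrakk> \<Longrightarrow> cross_right k d x y \<in> X"
  by (cases k; simp)+

text \<open>It suffices to parametrize the traces of both sides, with given bottom colors, by the same set of
  colors \<open>K xs\<close>, in such a way that both sides have the same top colors for each parameter and that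
  different parameters give different top colors. For a minimum past a strand the parameter is the color
  of the left leg at the top; otherwise there is at most one trace.\<close>

lemma local_equivI:
  fixes K :: "'x list \<Rightarrow> 'x set"
  assumes "T \<noteq> []" "tangle_diagram a T b" "tangle_diagram a T' b"
    and inj: "\<And>xs. set xs \<subseteq> X \<Longrightarrow> length xs = length a \<Longrightarrow> inj_on (Y xs) (K xs)"
    and T: "\<And>xs p ys. set xs \<subseteq> X \<Longrightarrow> length xs = length a \<Longrightarrow>
       trace xs T p ys \<longleftrightarrow> (\<exists>k\<in>K xs. p = P xs k \<and> ys = Y xs k)"
    and T': "\<And>xs p ys. set xs \<subseteq> X \<Longrightarrow> length xs = length a \<Longrightarrow>
       trace xs T' p ys \<longleftrightarrow> (\<exists>k\<in>K xs. p = P' xs k \<and> ys = Y xs k)"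
    and W: "\<And>xs k \<phi>. set xs \<subseteq> X \<Longrightarrow> length xs = length a \<Longrightarrow> k \<in> K xs \<Longrightarrow> \<phi> \<in> C \<Longrightarrow>
       trace_weight \<phi> xs T (P xs k) = trace_weight \<phi> xs T' (P' xs k)"
  shows "local_equiv T T'"
  unfolding local_equiv_def
proof (rule conjI, use assms(1) in blast, rule exI[of _ a], rule exI[of _ b],
    intro conjI allI impI ballI)
  fix xs ys :: "'x list" and p p' \<phi>
  assume xs: "set xs \<subseteq> X" "length xs = length a"
  show "\<exists>\<^sub>\<le>\<^sub>1 p. trace xs T p ys" "\<exists>\<^sub>\<le>\<^sub>1 p. trace xs T' p ys"
    using inj_onD[OF inj[OF xs]] unfolding T[OF xs] T'[OF xs] Uniq_def by metis+
  show "(\<exists>p. trace xs T p ys) \<longleftrightarrow> (\<exists>p. trace xs T' p ys)"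
    unfolding T[OF xs] T'[OF xs] by blast
  assume "trace xs T p ys" "trace xs T' p' ys" "\<phi> \<in> C"
  then show "trace_weight \<phi> xs T p = trace_weight \<phi> xs T' p'"
    using inj_onD[OF inj[OF xs]] W[OF xs] unfolding T[OF xs] T'[OF xs] by metis
qed (use assms(2,3) in blast)+

lemma slice_rel_simps:
  "slice_rel (Slice [] t []) xs ys \<longleftrightarrow> set xs \<subseteq> X \<and> set ys \<subseteq> X \<and> tile_rel t xs ys"
  "slice_rel (Slice [d] t []) xs ys \<longleftrightarrow>
    (\<exists>x bs ts. xs = x # bs \<and> ys = x # ts \<and> x \<in> X \<and> set bs \<subseteq> X \<and> set ts \<subseteq> X \<and> tile_rel t bs ts)"
  "slice_rel (Slice [] t [d]) xs ys \<longleftrightarrow>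
    (\<exists>x bs ts. xs = bs @ [x] \<and> ys = ts @ [x] \<and> x \<in> X \<and> set bs \<subseteq> X \<and> set ts \<subseteq> X \<and> tile_rel t bs ts)"
proof -
  show "slice_rel (Slice [d] t []) xs ys \<longleftrightarrow>
    (\<exists>x bs ts. xs = x # bs \<and> ys = x # ts \<and> x \<in> X \<and> set bs \<subseteq> X \<and> set ts \<subseteq> X \<and> tile_rel t bs ts)"
    (is "?L \<longleftrightarrow> ?R")
  proof
    assume ?L
    then obtain ls bs ts where "xs = ls @ bs" "ys = ls @ ts" "tile_rel t bs ts" "length ls = Suc 0"
      "set xs \<subseteq> X" "set ys \<subseteq> X"
      by (auto simp: slice_rel_def)
    then show ?R by (auto simp: length_Suc_conv)
  next
    assume ?R
    then obtain x bs ts where "xs = [x] @ bs @ []" "ys = [x] @ ts @ []" "tile_rel t bs ts"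
      "set xs \<subseteq> X" "set ys \<subseteq> X" by auto
    then show ?L unfolding slice_rel_def by (metis list.size slice.sel)
  qed
  show "slice_rel (Slice [] t [d]) xs ys \<longleftrightarrow>
    (\<exists>x bs ts. xs = bs @ [x] \<and> ys = ts @ [x] \<and> x \<in> X \<and> set bs \<subseteq> X \<and> set ts \<subseteq> X \<and> tile_rel t bs ts)"
    (is "?L \<longleftrightarrow> ?R")
  proof
    assume ?L
    then obtain rs bs ts where "xs = bs @ rs" "ys = ts @ rs" "tile_rel t bs ts" "length rs = Suc 0"
      "set xs \<subseteq> X" "set ys \<subseteq> X"
      by (auto simp: slice_rel_def)
    then show ?R by (auto simp: length_Suc_conv)
  next
    assume ?R
    then obtain x bs ts where "xs = [] @ bs @ [x]" "ys = [] @ ts @ [x]" "tile_rel t bs ts"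
      "set xs \<subseteq> X" "set ys \<subseteq> X" by auto
    then show ?L unfolding slice_rel_def by (metis list.size slice.sel)
  qed
qed (unfold slice_rel_def, metis append_Nil append_Nil2 length_0_conv list.size(3) slice.sel)

lemma slice_weight_simps:
  "slice_weight \<phi> (Slice l (Cup d) r) xs = 0"
  "slice_weight \<phi> (Slice l (Cap d) r) xs = 0"
  "slice_weight \<phi> (Slice [] (Cross k d1 d2) r) (x # y # rs) = tile_weight \<phi> (Cross k d1 d2) [x, y]"
  "slice_weight \<phi> (Slice [d] (Cross k d1 d2) r) (z # x # y # rs) = tile_weight \<phi> (Cross k d1 d2) [x, y]"
  by (simp_all add: slice_weight_def)

lemma signed_simps [simp]:
  "signed d 0 = 0" "signed (opp d) a = - signed d a" "signed d (- a) = - signed d a"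
  "signed d (a + b) = signed d a + signed d b" "signed d (a - b) = signed d a - signed d b"
  by (cases d; simp)+

lemma pass_self_iff': "\<lbrakk>x \<in> X; y \<in> X\<rbrakk> \<Longrightarrow> y = pass d y x \<longleftrightarrow> x = y"
  using pass_self_iff[of x y d] by auto

lemmas local_simps = slice_rel_simps slice_weight_simps length_Suc_conv bottom_def top_def

lemma local_equiv_zigzag_right:
  "local_equiv [Slice [d] (Cup (opp d)) [], Slice [] (Cap d) [d]] []"
  by (rule local_equivI[where a="[d]" and b="[d]" and K = "\<lambda>xs. set xs"
        and P = "\<lambda>xs x. [[x,x,x],[x]]" and P' = "\<lambda>_ _. []" and Y = "\<lambda>_ x. [x]"])
     (auto simp: local_simps inj_on_def)

lemma local_equiv_zigzag_left:
  "local_equiv [Slice [] (Cup d) [d], Slice [d] (Cap (opp d)) []] []"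
  by (rule local_equivI[where a="[d]" and b="[d]" and K = "\<lambda>xs. set xs"
        and P = "\<lambda>xs x. [[x,x,x],[x]]" and P' = "\<lambda>_ _. []" and Y = "\<lambda>_ x. [x]"])
     (auto simp: local_simps inj_on_def)

text \<open>At a classical crossing the strand passes below itself. Closing up the kink is possible only if it has one color \<open>x\<close>
  throughout, because an action of \<open>y\<close> fixes \<open>y\<close> and is injective; the weight is that of the
  degenerate pair \<open>(x, x)\<close>.\<close>

lemma local_equiv_kink_right:
  "local_equiv [Slice [d] (Cup d) [], Slice [] (Cross k d d) [opp d], Slice [d] (Cap d) []] []"
  by (rule local_equivI[where a="[d]" and b="[d]" and K = "\<lambda>xs. set xs"
        and P = "\<lambda>xs x. [[x,x,x],[x,x,x],[x]]" and P' = "\<lambda>_ _. []" and Y = "\<lambda>_ x. [x]"]; cases k)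
     (auto simp: local_simps inj_on_def pass_self_iff pass_self_iff')

lemma local_equiv_kink_left:
  "local_equiv [Slice [] (Cup (opp d)) [d], Slice [opp d] (Cross k d d) [], Slice [] (Cap (opp d)) [d]] []"
  by (rule local_equivI[where a="[d]" and b="[d]" and K = "\<lambda>xs. set xs"
        and P = "\<lambda>xs x. [[x,x,x],[x,x,x],[x]]" and P' = "\<lambda>_ _. []" and Y = "\<lambda>_ x. [x]"]; cases k)
     (auto simp: local_simps inj_on_def pass_self_iff pass_self_iff')

text \<open>If the crossings are classical, the two passages below the over-strand are inverse to each other, and
  their weights cancel.\<close>

lemma local_equiv_R2:
  "local_equiv [Slice [] (Cross k d1 d2) [], Slice [] (Cross (flip k) d2 d1) []] []"
  by (rule local_equivI[where a="[d1, d2]" and b="[d1, d2]" and K = "\<lambda>xs. {xs ! 0}"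
        and P = "\<lambda>xs x. [[cross_left k d1 x (xs ! 1), cross_right k d2 x (xs ! 1)],[x, xs ! 1]]"
        and P' = "\<lambda>_ _. []" and Y = "\<lambda>xs x. [x, xs ! 1]"]; cases k)
     (auto simp: local_simps inj_on_def pass_weight_opp pass_weight_opp')

text \<open>On each side the top colors are composites of the passages in a different order. In the classical
  cases they agree by self-distributivity and the weights by the cocycle condition; with at least two
  virtual crossings at most one passage is left, with the same colors on both sides.\<close>

lemma local_equiv_R3:
  assumes "Virt \<notin> {k12, k13, k23} \<and> \<not> (k12 = k23 \<and> k13 \<noteq> k12) \<or>
    k12 = Virt \<and> k13 = Virt \<or> k12 = Virt \<and> k23 = Virt \<or> k13 = Virt \<and> k23 = Virt"
  shows "local_equiv
     [Slice [] (Cross k12 d1 d2) [d3], Slice [d2] (Cross k13 d1 d3) [], Slice [] (Cross k23 d2 d3) [d1]]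
     [Slice [d1] (Cross k23 d2 d3) [], Slice [] (Cross k13 d1 d3) [d2], Slice [d3] (Cross k12 d1 d2) []]"
proof -
  define P where "P xs = (let x = xs ! 0; y = xs ! 1; z = xs ! 2;
     y' = cross_left k12 d1 x y; x' = cross_right k12 d2 x y;
     z' = cross_left k13 d1 x' z; x'' = cross_right k13 d3 x' z;
     z'' = cross_left k23 d2 y' z'; y'' = cross_right k23 d3 y' z'
     in [[y', x', z], [y', z', x''], [z'', y'', x'']])" for xs
  define P' where "P' xs = (let x = xs ! 0; y = xs ! 1; z = xs ! 2;
     z' = cross_left k23 d2 y z; y' = cross_right k23 d3 y z;
     z'' = cross_left k13 d1 x z'; x' = cross_right k13 d3 x z';
     y'' = cross_left k12 d1 x' y'; x'' = cross_right k12 d2 x' y'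
     in [[x, z', y'], [z'', x', y'], [z'', y'', x'']])" for xs
  have YB: "last (P [x, y, z]) = last (P' [x, y, z])"
    if "x \<in> X" "y \<in> X" "z \<in> X" for x y z
    using assms that unfolding P_def P'_def
    by (cases k12; cases k13; cases k23) (simp_all add: pass_conj Let_def)
  have W: "trace_weight \<phi> [x, y, z] [Slice [] (Cross k12 d1 d2) [d3], Slice [d2] (Cross k13 d1 d3) [], Slice [] (Cross k23 d2 d3) [d1]] (P [x, y, z]) =
     trace_weight \<phi> [x, y, z] [Slice [d1] (Cross k23 d2 d3) [], Slice [] (Cross k13 d1 d3) [d2], Slice [d3] (Cross k12 d1 d2) []] (P' [x, y, z])"
    if "x \<in> X" "y \<in> X" "z \<in> X" "\<phi> \<in> C" for x y z \<phi>
    using assms that unfolding P_def P'_def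
    by (cases k12; cases k13; cases k23)
       (simp_all add: pass_conj pass_weight_conj pass_weight_opp pass_weight_opp' slice_weight_simps Let_def algebra_simps)
  show ?thesis
    apply (rule local_equivI[where a="[d1, d2, d3]" and b="[d3, d2, d1]" and K = "\<lambda>xs. {xs ! 0}"
        and P = "\<lambda>xs _. P xs" and P' = "\<lambda>xs _. P' xs" and Y = "\<lambda>xs _. last (P xs)"])
          apply (simp_all add: bottom_def top_def)
    subgoal by (auto simp: length_Suc_conv P_def slice_rel_simps Let_def)
    subgoal for xs p ys
      using YB[of "xs ! 0" "xs ! 1" "xs ! 2"]
      by (auto simp: length_Suc_conv P'_def slice_rel_simps Let_def)
    subgoal for xs k \<phi>
      using W[of "xs ! 0" "xs ! 1" "xs ! 2" \<phi>]
      by (auto simp: length_Suc_conv)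
    done
qed

text \<open>The two legs of the minimum have opposite directions. If the strand passes above the minimum, then on
  one side it crosses the right leg and on the other side the left leg, so the two passages are inverse to
  each other; the direction of the under-strand relative to the page changes as well, and the weights
  agree.\<close>

lemma local_equiv_cup_past_strand:
  "local_equiv
       [Slice [] (Cup d) [e], Slice [d] (Cross k (opp d) e) []]
       [Slice [e] (Cup d) [], Slice [] (Cross (flip k) e d) [opp d]]"
proof (cases k)
  case OverNW
  show ?thesis
    unfolding OverNW
    by (rule local_equivI[where a="[e]" and b="[d, e, opp d]" and K = "\<lambda>_. X"
        and P = "\<lambda>xs u. [[u, u, xs ! 0], [u, xs ! 0, pass (opp e) (xs ! 0) u]]"
        and P' = "\<lambda>xs u. [[xs ! 0, pass (opp e) (xs ! 0) u, pass (opp e) (xs ! 0) u], [u, xs ! 0, pass (opp e) (xs ! 0) u]]"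
        and Y = "\<lambda>xs u. [u, xs ! 0, pass (opp e) (xs ! 0) u]"])
      (auto simp: local_simps inj_on_def pass_weight_opp pass_weight_opp')
next
  case OverNE
  show ?thesis
    unfolding OverNE
    by (rule local_equivI[where a="[e]" and b="[d, e, opp d]" and K = "\<lambda>_. X"
        and P = "\<lambda>xs u. [[u, u, xs ! 0], [u, pass (opp d) u (xs ! 0), u]]"
        and P' = "\<lambda>xs u. [[xs ! 0, u, u], [u, pass (opp d) u (xs ! 0), u]]"
        and Y = "\<lambda>xs u. [u, pass (opp d) u (xs ! 0), u]"])
      (auto simp: local_simps inj_on_def)
next
  case Virt
  show ?thesis
    unfolding Virt
    by (rule local_equivI[where a="[e]" and b="[d, e, opp d]" and K = "\<lambda>_. X"
        and P = "\<lambda>xs u. [[u, u, xs ! 0], [u, xs ! 0, u]]"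
        and P' = "\<lambda>xs u. [[xs ! 0, u, u], [u, xs ! 0, u]]"
        and Y = "\<lambda>xs u. [u, xs ! 0, u]"])
      (auto simp: local_simps inj_on_def)
qed

lemma local_equiv_cap_past_strand:
  "local_equiv
       [Slice [] (Cross k d e) [opp d], Slice [e] (Cap d) []]
       [Slice [d] (Cross (flip k) e (opp d)) [], Slice [] (Cap d) [e]]"
proof (cases k)
  case OverNW
  show ?thesis
    unfolding OverNW
    by (rule local_equivI[where a="[d, e, opp d]" and b="[e]"
        and K = "\<lambda>xs. {u. u = xs ! 1 \<and> xs ! 2 = pass (opp e) (xs ! 1) (xs ! 0)}"
        and P = "\<lambda>xs u. [[u, xs ! 2, xs ! 2], [u]]"
        and P' = "\<lambda>xs u. [[xs ! 0, xs ! 0, u], [u]]"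
        and Y = "\<lambda>xs u. [u]"])
      (auto simp: local_simps inj_on_def pass_weight_opp pass_weight_opp')
next
  case OverNE
  show ?thesis
    unfolding OverNE
    by (rule local_equivI[where a="[d, e, opp d]" and b="[e]"
        and K = "\<lambda>xs. if xs ! 2 = xs ! 0 then {xs ! 0} else {}"
        and P = "\<lambda>xs u. [[pass d u (xs ! 1), u, u], [pass d u (xs ! 1)]]"
        and P' = "\<lambda>xs u. [[u, u, pass d u (xs ! 1)], [pass d u (xs ! 1)]]"
        and Y = "\<lambda>xs u. [pass d u (xs ! 1)]"])
      (auto simp: local_simps split: if_splits)
next
  case Virt
  show ?thesis
    unfolding Virt
    by (rule local_equivI[where a="[d, e, opp d]" and b="[e]"
        and K = "\<lambda>xs. if xs ! 2 = xs ! 0 then {xs ! 0} else {}"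
        and P = "\<lambda>xs u. [[xs ! 1, u, u], [xs ! 1]]"
        and P' = "\<lambda>xs u. [[u, u, xs ! 1], [xs ! 1]]"
        and Y = "\<lambda>xs u. [xs ! 1]"])
      (auto simp: local_simps split: if_splits)
qed

lemma slice_rel_left_end:
  "slice_rel (Slice [] t r) xs ys \<longleftrightarrow> set xs \<subseteq> X \<and> set ys \<subseteq> X \<and>
     (\<exists>bs ts rs. xs = bs @ rs \<and> ys = ts @ rs \<and> tile_rel t bs ts \<and> length rs = length r)"
  unfolding slice_rel_def by simp

lemma slice_rel_right_end:
  "slice_rel (Slice l t []) xs ys \<longleftrightarrow> set xs \<subseteq> X \<and> set ys \<subseteq> X \<and>
     (\<exists>ls bs ts. xs = ls @ bs \<and> ys = ls @ ts \<and> tile_rel t bs ts \<and> length ls = length l)"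
  unfolding slice_rel_def by simp

text \<open>Distant tiles act on disjoint parts of a row, so the traces of two such tiles in either order are
  given by the same pair of local colorings.\<close>

lemma trace_distant_lower_first:
  "trace xs [Slice [] t (m @ tile_bottom t'), Slice (tile_top t @ m) t' []] p ys \<longleftrightarrow>
   (\<exists>bs ts ms bs' ts'. tile_rel t bs ts \<and> tile_rel t' bs' ts' \<and> length ms = length m \<and>
      set (bs @ ts @ ms @ bs' @ ts') \<subseteq> X \<and> xs = bs @ ms @ bs' \<and>
      p = [ts @ ms @ bs', ts @ ms @ ts'] \<and> ys = ts @ ms @ ts')"
  (is "?L \<longleftrightarrow> ?R")
proof
  assume ?L
  then obtain zs where zs: "p = [zs, ys]" "slice_rel (Slice [] t (m @ tile_bottom t')) xs zs"
      "slice_rel (Slice (tile_top t @ m) t' []) zs ys" by auto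
  from zs obtain bs ts rs ls bs' ts' where *: "p = [zs, ys]" "set xs \<subseteq> X" "set zs \<subseteq> X" "set ys \<subseteq> X"
    "xs = bs @ rs" "zs = ts @ rs" "tile_rel t bs ts" "length rs = length m + length (tile_bottom t')"
    "zs = ls @ bs'" "ys = ls @ ts'" "tile_rel t' bs' ts'" "length ls = length (tile_top t) + length m"
    unfolding slice_rel_left_end slice_rel_right_end length_append by (elim exE conjE) blast
  define ms where "ms = drop (length ts) ls"
  have "ls = ts @ ms"
    using arg_cong[OF *(9), of "take (length ts)"] *(6,12) tile_rel_length[OF *(7)]
    by (simp add: ms_def)
  moreover from this have "rs = ms @ bs'" using *(6,9) by simp
  ultimately have "xs = bs @ ms @ bs'" "p = [ts @ ms @ bs', ts @ ms @ ts']"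
      "ys = ts @ ms @ ts'" "set (bs @ ts @ ms @ bs' @ ts') \<subseteq> X" "length ms = length m"
    using * tile_rel_length[OF *(7)] by auto
  with *(7,11) show ?R by blast
next
  assume ?R
  then obtain bs ts ms bs' ts' where *: "tile_rel t bs ts" "tile_rel t' bs' ts'" "length ms = length m"
      "set (bs @ ts @ ms @ bs' @ ts') \<subseteq> X" "xs = bs @ ms @ bs'"
      "p = [ts @ ms @ bs', ts @ ms @ ts']" "ys = ts @ ms @ ts'" by blast
  have "slice_rel (Slice [] t (m @ tile_bottom t')) (bs @ ms @ bs') (ts @ ms @ bs')"
    unfolding slice_rel_left_end using * tile_rel_length[OF *(2)] by (intro conjI exI[of _ bs] exI[of _ ts] exI[of _ "ms @ bs'"]) simp_all
  moreover have "slice_rel (Slice (tile_top t @ m) t' []) (ts @ ms @ bs') (ts @ ms @ ts')"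
    unfolding slice_rel_right_end using * tile_rel_length[OF *(1)] by (intro conjI exI[of _ "ts @ ms"] exI[of _ bs'] exI[of _ ts']) simp_all
  ultimately show ?L using * by simp
qed

lemma trace_distant_upper_first:
  "trace xs [Slice (tile_bottom t @ m) t' [], Slice [] t (m @ tile_top t')] p ys \<longleftrightarrow>
   (\<exists>bs ts ms bs' ts'. tile_rel t bs ts \<and> tile_rel t' bs' ts' \<and> length ms = length m \<and>
      set (bs @ ts @ ms @ bs' @ ts') \<subseteq> X \<and> xs = bs @ ms @ bs' \<and>
      p = [bs @ ms @ ts', ts @ ms @ ts'] \<and> ys = ts @ ms @ ts')"
  (is "?L \<longleftrightarrow> ?R")
proof
  assume ?L
  then obtain zs where zs: "p = [zs, ys]" "slice_rel (Slice (tile_bottom t @ m) t' []) xs zs"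
      "slice_rel (Slice [] t (m @ tile_top t')) zs ys" by auto
  from zs obtain bs ts rs ls bs' ts' where *: "p = [zs, ys]" "set xs \<subseteq> X" "set zs \<subseteq> X" "set ys \<subseteq> X"
    "zs = bs @ rs" "ys = ts @ rs" "tile_rel t bs ts" "length rs = length m + length (tile_top t')"
    "xs = ls @ bs'" "zs = ls @ ts'" "tile_rel t' bs' ts'" "length ls = length (tile_bottom t) + length m"
    unfolding slice_rel_left_end slice_rel_right_end length_append by (elim exE conjE) blast
  define ms where "ms = drop (length bs) ls"
  have "ls = bs @ ms"
    using arg_cong[OF *(10), of "take (length bs)"] *(5,12) tile_rel_length[OF *(7)]
    by (simp add: ms_def)
  moreover from this have "rs = ms @ ts'" using *(5,10) by simp
  ultimately have "xs = bs @ ms @ bs'" "p = [bs @ ms @ ts', ts @ ms @ ts']"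
      "ys = ts @ ms @ ts'" "set (bs @ ts @ ms @ bs' @ ts') \<subseteq> X" "length ms = length m"
    using * tile_rel_length[OF *(7)] by auto
  with *(7,11) show ?R by blast
next
  assume ?R
  then obtain bs ts ms bs' ts' where *: "tile_rel t bs ts" "tile_rel t' bs' ts'" "length ms = length m"
      "set (bs @ ts @ ms @ bs' @ ts') \<subseteq> X" "xs = bs @ ms @ bs'"
      "p = [bs @ ms @ ts', ts @ ms @ ts']" "ys = ts @ ms @ ts'" by blast
  have "slice_rel (Slice (tile_bottom t @ m) t' []) (bs @ ms @ bs') (bs @ ms @ ts')"
    unfolding slice_rel_right_end using * tile_rel_length[OF *(1)] by (intro conjI exI[of _ "bs @ ms"] exI[of _ bs'] exI[of _ ts']) simp_all
  moreover have "slice_rel (Slice [] t (m @ tile_top t')) (bs @ ms @ ts') (ts @ ms @ ts')"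
    unfolding slice_rel_left_end using * tile_rel_length[OF *(2)] by (intro conjI exI[of _ bs] exI[of _ ts] exI[of _ "ms @ ts'"]) simp_all
  ultimately show ?L using * by simp
qed

lemma local_equiv_distant_tiles:
  "local_equiv
       [Slice [] t (m @ tile_bottom t'), Slice (tile_top t @ m) t' []]
       [Slice (tile_bottom t @ m) t' [], Slice [] t (m @ tile_top t')]"
  (is "local_equiv ?T ?T'")
  unfolding local_equiv_def
proof (rule conjI, simp, rule exI[of _ "tile_bottom t @ m @ tile_bottom t'"],
    rule exI[of _ "tile_top t @ m @ tile_top t'"], intro conjI allI impI ballI)
  fix xs ys :: "'x list"
  have unique: "bs = bs2 \<and> ts = ts2 \<and> ms = ms2 \<and> bs' = bs2' \<and> ts' = ts2'"
    if "tile_rel t bs ts" "tile_rel t' bs' ts'" "length ms = length m" "xs = bs @ ms @ bs'" "ys = ts @ ms @ ts'"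
      "tile_rel t bs2 ts2" "tile_rel t' bs2' ts2'" "length ms2 = length m"
      "xs = bs2 @ ms2 @ bs2'" "ys = ts2 @ ms2 @ ts2'"
    for bs ts ms bs' ts' bs2 ts2 ms2 bs2' ts2'
    using that by (auto dest!: tile_rel_length)
  show "\<exists>\<^sub>\<le>\<^sub>1 p. trace xs ?T p ys"
    unfolding Uniq_def trace_distant_lower_first using unique by (elim exE conjE | intro allI impI)+ metis
  show "\<exists>\<^sub>\<le>\<^sub>1 p. trace xs ?T' p ys"
    unfolding Uniq_def trace_distant_upper_first using unique by (elim exE conjE | intro allI impI)+ metis
  show "(\<exists>p. trace xs ?T p ys) \<longleftrightarrow> (\<exists>p. trace xs ?T' p ys)"
    unfolding trace_distant_lower_first trace_distant_upper_first by blast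
  fix p p' \<phi>
  assume "trace xs ?T p ys" "trace xs ?T' p' ys"
  then obtain bs ts ms bs' ts' where *: "tile_rel t bs ts" "tile_rel t' bs' ts'" "length ms = length m"
    "xs = bs @ ms @ bs'" "ys = ts @ ms @ ts'"
    "p = [ts @ ms @ bs', ts @ ms @ ts']" "p' = [bs @ ms @ ts', ts @ ms @ ts']"
    unfolding trace_distant_lower_first trace_distant_upper_first
    using unique by (elim exE conjE) metis
  then show "trace_weight \<phi> xs ?T p = trace_weight \<phi> xs ?T' p'"
    using tile_rel_length[OF *(1)] tile_rel_length[OF *(2)]
    by (simp add: slice_weight_def add.commute)
qed (simp_all add: bottom_def top_def)

lemma local_equiv_move:
  assumes "planar_isotopy T T' \<or> classical_reidemeister T T' \<or> virtual_reidemeister T T'"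
  shows "local_equiv T T'"
  using assms
proof (elim disjE)
  assume "planar_isotopy T T'"
  then show ?thesis
    by cases (simp_all only: local_equiv_distant_tiles local_equiv_zigzag_right local_equiv_zigzag_left
        local_equiv_cup_past_strand local_equiv_cap_past_strand)
next
  have R1: "R1 k T T' \<Longrightarrow> local_equiv T T'" for k
    by (erule R1.cases) (simp_all only: local_equiv_kink_right local_equiv_kink_left)
  have R2: "R2 k T T' \<Longrightarrow> local_equiv T T'" for k
    by (erule R2.cases) (simp only: local_equiv_R2)
  have R3: "R3 k12 k13 k23 T T' \<Longrightarrow>
    Virt \<notin> {k12, k13, k23} \<and> \<not> (k12 = k23 \<and> k13 \<noteq> k12) \<or>
    k12 = Virt \<and> k13 = Virt \<or> k12 = Virt \<and> k23 = Virt \<or> k13 = Virt \<and> k23 = Virt \<Longrightarrow>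
    local_equiv T T'" for k12 k13 k23
    by (erule R3.cases) (simp only: local_equiv_R3)
  show ?thesis if "classical_reidemeister T T'"
    using that by cases (use R1 R2 R3 in blast)+
  show ?thesis if "virtual_reidemeister T T'"
    using that by cases (use R1 R2 R3 in blast)+
qed

end

section \<open>Moves inside a link diagram\<close>

lemma bij_betw_of_relation:
  assumes "\<And>x. x \<in> A \<Longrightarrow> \<exists>y\<in>B. R x y" "\<And>y. y \<in> B \<Longrightarrow> \<exists>x\<in>A. R x y"
    and right_unique: "\<And>x y y'. R x y \<Longrightarrow> R x y' \<Longrightarrow> y = y'"
    and left_unique: "\<And>x x' y. R x y \<Longrightarrow> R x' y \<Longrightarrow> x = x'"
  shows "\<exists>f. bij_betw f A B \<and> (\<forall>x\<in>A. R x (f x))"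
proof -
  obtain f where f: "\<And>x. x \<in> A \<Longrightarrow> f x \<in> B \<and> R x (f x)"
    using assms(1) by metis
  have "inj_on f A"
    using f left_unique by (metis inj_onI)
  moreover have "f ` A = B"
    using f assms(2) right_unique by (metis image_eqI image_subsetI subsetI subset_antisym)
  ultimately show ?thesis
    using f by (auto simp: bij_betw_def)
qed

context quandle_with_cocycles
begin

lemma tangle_diagram_pad:
  "tangle_diagram a T b \<Longrightarrow> tangle_diagram (l @ a @ r) (map (pad l r) T) (l @ b @ r)"
proof (induction T arbitrary: a)
  case (Cons s T)
  have "bottom (pad l r s) = l @ bottom s @ r" "top (pad l r s) = l @ top s @ r"
    by (simp_all add: pad_def bottom_def top_def)
  then show ?case using Cons.IH[of "top s"] Cons.prems by simp
qed simp

text \<open>The boundary rows of the padded tangles split into the colors of the vertical strands, which stay the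
  same, and the boundary rows of the original tangles.\<close>

lemma local_equiv_pad:
  assumes "local_equiv T T'"
  shows "local_equiv (map (pad l r) T) (map (pad l r) T')"
proof -
  from assms obtain a b where *: "T \<noteq> [] \<or> T' \<noteq> []"
    "tangle_diagram a T b" "tangle_diagram a T' b" and
    **: "\<And>xs ys. \<lbrakk>set xs \<subseteq> X; length xs = length a\<rbrakk> \<Longrightarrow>
          (\<exists>\<^sub>\<le>\<^sub>1 p. trace xs T p ys) \<and> (\<exists>\<^sub>\<le>\<^sub>1 p. trace xs T' p ys) \<and>
          ((\<exists>p. trace xs T p ys) \<longleftrightarrow> (\<exists>p. trace xs T' p ys)) \<and>
          (\<forall>p p'. trace xs T p ys \<longrightarrow> trace xs T' p' ys \<longrightarrow>
             (\<forall>\<phi>\<in>C. trace_weight \<phi> xs T p = trace_weight \<phi> xs T' p'))"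
    unfolding local_equiv_def by blast
  show ?thesis
    unfolding local_equiv_def
  proof (rule conjI, use *(1) in simp, rule exI[of _ "l @ a @ r"], rule exI[of _ "l @ b @ r"],
      intro conjI allI impI ballI)
    fix zs us :: "'x list" and p p' \<phi>
    assume zs: "set zs \<subseteq> X" "length zs = length (l @ a @ r)"
    define ls xs rs where "ls = take (length l) zs" and "xs = take (length a) (drop (length l) zs)"
      and "rs = drop (length a) (drop (length l) zs)"
    have zs_eq: "zs = ls @ xs @ rs"
      by (simp only: ls_def xs_def rs_def append_take_drop_id)
    have len: "length ls = length l" "length rs = length r" and sub: "set ls \<subseteq> X" "set rs \<subseteq> X"
      and xs: "set xs \<subseteq> X" "length xs = length a"
    proof -
      show "length ls = length l" "length rs = length r" "length xs = length a"
        using zs(2) by (simp_all add: ls_def xs_def rs_def)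
      show "set ls \<subseteq> X" "set rs \<subseteq> X" "set xs \<subseteq> X"
        using zs(1) unfolding zs_eq by simp_all
    qed
    note pad_iff = trace_pad[OF len sub, of xs]
    have unique: "\<exists>\<^sub>\<le>\<^sub>1 p. trace zs (map (pad l r) U) p us" if "\<And>ys. \<exists>\<^sub>\<le>\<^sub>1 p. trace xs U p ys" for U
    proof (rule Uniq_I)
      fix p p' assume "trace zs (map (pad l r) U) p us" "trace zs (map (pad l r) U) p' us"
      then obtain q q' ys where "p = map (\<lambda>c. ls @ c @ rs) q" "p' = map (\<lambda>c. ls @ c @ rs) q'"
        "trace xs U q ys" "trace xs U q' ys"
        unfolding zs_eq pad_iff by auto
      moreover from this have "q = q'" using that[of ys] unfolding Uniq_def by blast
      ultimately show "p = p'" by simp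
    qed
    show "\<exists>\<^sub>\<le>\<^sub>1 p. trace zs (map (pad l r) T) p us" "\<exists>\<^sub>\<le>\<^sub>1 p. trace zs (map (pad l r) T') p us"
      using **[OF xs] by (simp_all add: unique)
    show "(\<exists>p. trace zs (map (pad l r) T) p us) \<longleftrightarrow> (\<exists>p. trace zs (map (pad l r) T') p us)"
    proof -
      have "(\<exists>p. trace zs (map (pad l r) U) p us) \<longleftrightarrow> (\<exists>q ys. us = ls @ ys @ rs \<and> trace xs U q ys)" for U
        unfolding zs_eq pad_iff by blast
      then show ?thesis using **[OF xs] by simp metis
    qed
    assume "trace zs (map (pad l r) T) p us" "trace zs (map (pad l r) T') p' us" "\<phi> \<in> C"
    then obtain q q' ys where "p = map (\<lambda>c. ls @ c @ rs) q" "p' = map (\<lambda>c. ls @ c @ rs) q'"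
        "trace xs T q ys" "trace xs T' q' ys"
      unfolding zs_eq pad_iff by auto
    then show "trace_weight \<phi> zs (map (pad l r) T) p = trace_weight \<phi> zs (map (pad l r) T') p'"
      using **[OF xs, of ys] \<open>\<phi> \<in> C\<close> trace_weight_pad[OF len(1)] unfolding zs_eq by metis
  qed (use * tangle_diagram_pad in blast)+
qed

text \<open>An endomorphism respects the inverse actions too, because these are determined by the actions.\<close>

lemma endo_pass:
  assumes "\<sigma> \<in> quandle_endomorphisms X tri" "x \<in> X" "y \<in> X"
  shows "\<sigma> (pass d y x) = pass d (\<sigma> y) (\<sigma> x)"
proof -
  have closed: "\<sigma> z \<in> X" if "z \<in> X" for z
    using assms(1) that by (auto simp: quandle_endomorphisms_def)
  have Up: "\<sigma> (pass Up v u) = pass Up (\<sigma> v) (\<sigma> u)" if "u \<in> X" "v \<in> X" for u v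
    using assms(1) that by (simp add: quandle_endomorphisms_def pass_def)
  show ?thesis
  proof (cases d)
    case Down
    have "\<sigma> x = pass Up (\<sigma> y) (\<sigma> (pass Down y x))"
      using Up[of "pass Down y x" y] pass_pass_opp[of x y Up] assms by simp
    then show ?thesis
      using pass_opp_pass[of "\<sigma> (pass Down y x)" "\<sigma> y" Up] closed assms Down by simp
  qed (use Up assms in simp)
qed

lemma tile_rel_endo:
  assumes "\<sigma> \<in> quandle_endomorphisms X tri" "tile_rel t bs ts" "set bs \<subseteq> X"
  shows "tile_rel t (map \<sigma> bs) (map \<sigma> ts)"
proof (cases t)
  case (Cross k d1 d2)
  then show ?thesis
    using assms by (cases k) (auto simp: endo_pass)
qed (use assms in auto)

lemma slice_rel_endo:
  assumes \<sigma>: "\<sigma> \<in> quandle_endomorphisms X tri" and "slice_rel s xs ys"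
  shows "slice_rel s (map \<sigma> xs) (map \<sigma> ys)"
proof -
  obtain ls bs ts rs where *: "set xs \<subseteq> X" "set ys \<subseteq> X" "xs = ls @ bs @ rs" "ys = ls @ ts @ rs"
    "tile_rel (tile_of s) bs ts" "length ls = length (left_of s)" "length rs = length (right_of s)"
    using assms(2) unfolding slice_rel_def by blast
  have "set (map \<sigma> xs) \<subseteq> X" "set (map \<sigma> ys) \<subseteq> X"
    using *(1,2) \<sigma> by (auto simp: quandle_endomorphisms_def)
  moreover have "tile_rel (tile_of s) (map \<sigma> bs) (map \<sigma> ts)"
    using tile_rel_endo[OF \<sigma> *(5)] *(1,3) by simp
  ultimately show ?thesis
    unfolding slice_rel_def
    by (intro conjI exI[of _ "map \<sigma> ls"] exI[of _ "map \<sigma> bs"] exI[of _ "map \<sigma> ts"] exI[of _ "map \<sigma> rs"])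
       (simp_all add: *(3,4,6,7))
qed

lemma trace_endo:
  assumes "\<sigma> \<in> quandle_endomorphisms X tri"
  shows "trace xs T css ys \<Longrightarrow> trace (map \<sigma> xs) T (map (map \<sigma>) css) (map \<sigma> ys)"
  by (induction T arbitrary: xs css) (auto simp: slice_rel_endo[OF assms])

definition link_traces :: "slice list \<Rightarrow> 'x list list set" where
  "link_traces D = {css. trace [] D css []}"

lemma tangle_diagram_append:
  "tangle_diagram a (T @ U) b \<longleftrightarrow> (\<exists>c. tangle_diagram a T c \<and> tangle_diagram c U b)"
  by (induction T arbitrary: a) auto

lemma tangle_diagram_top_unique:
  "tangle_diagram a T b \<Longrightarrow> tangle_diagram a T c \<Longrightarrow> b = c"
  by (induction T arbitrary: a) auto

lemma tangle_diagram_bottom_unique: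
  "tangle_diagram a T b \<Longrightarrow> tangle_diagram c T d \<Longrightarrow> T \<noteq> [] \<Longrightarrow> a = c"
  by (cases T) auto

lemma trace_append3:
  "trace xs (T @ U @ V) css ys \<longleftrightarrow> (\<exists>c p d zs us.
     css = c @ p @ d \<and> trace xs T c zs \<and> trace zs U p us \<and> trace us V d ys)"
  by (simp only: trace_append) metis

text \<open>Corresponding traces agree below and above the move. Each determines the other by uniqueness inside
  the move, and an endomorphism applied to corresponding traces gives corresponding traces.\<close>

lemma link_traces_bij:
  assumes eq: "local_equiv P P'" and D: "link_diagram D" "D = B @ P @ A"
    and D': "link_diagram D'" "D' = B @ P' @ A"
  shows "\<exists>f. bij_betw f (link_traces D) (link_traces D') \<and>
    (\<forall>css\<in>link_traces D. \<forall>\<sigma>\<in>quandle_endomorphisms X tri. f (map (map \<sigma>) css) = map (map \<sigma>) (f css)) \<and>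
    (\<forall>css\<in>link_traces D. \<forall>\<phi>\<in>C. trace_weight \<phi> [] D' (f css) = trace_weight \<phi> [] D css)"
proof -
  obtain a b where ab: "P \<noteq> [] \<or> P' \<noteq> []"
    "tangle_diagram a P b" "tangle_diagram a P' b" and
    P: "\<And>xs ys. \<lbrakk>set xs \<subseteq> X; length xs = length a\<rbrakk> \<Longrightarrow>
          (\<exists>\<^sub>\<le>\<^sub>1 p. trace xs P p ys) \<and> (\<exists>\<^sub>\<le>\<^sub>1 p. trace xs P' p ys) \<and>
          ((\<exists>p. trace xs P p ys) \<longleftrightarrow> (\<exists>p. trace xs P' p ys)) \<and>
          (\<forall>p p'. trace xs P p ys \<longrightarrow> trace xs P' p' ys \<longrightarrow>
             (\<forall>\<phi>\<in>C. trace_weight \<phi> xs P p = trace_weight \<phi> xs P' p'))"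
    using eq unfolding local_equiv_def by blast
  have B: "tangle_diagram [] B a"
  proof -
    obtain c d c' d' where c: "tangle_diagram [] B c" "tangle_diagram c P d"
        "tangle_diagram [] B c'" "tangle_diagram c' P' d'"
      using D D' by (auto simp: link_diagram_def tangle_diagram_append)
    then have "c = c'" using tangle_diagram_top_unique by blast
    then show ?thesis using ab c tangle_diagram_bottom_unique by metis
  qed
  have zs: "set zs \<subseteq> X" "length zs = length a" if "trace [] B c zs" for c zs
    using trace_set[OF that] trace_tangle_length[OF B that] by simp_all
  define R where "R css css' \<longleftrightarrow> (\<exists>c p p' d zs us. css = c @ p @ d \<and> css' = c @ p' @ d \<and>
      trace [] B c zs \<and> trace zs P p us \<and> trace zs P' p' us \<and> trace us A d [])" for css css'
  have total: "\<exists>css'\<in>link_traces D'. R css css'" if css: "css \<in> link_traces D" for css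
  proof -
    obtain c p d zs us where *: "css = c @ p @ d" "trace [] B c zs" "trace zs P p us" "trace us A d []"
      using css unfolding link_traces_def D(2) mem_Collect_eq trace_append3 by blast
    then obtain p' where "trace zs P' p' us" using P[OF zs] by blast
    with * have "R css (c @ p' @ d)" "trace [] D' (c @ p' @ d) []"
      unfolding D'(2) trace_append3 R_def by blast+
    then show ?thesis unfolding link_traces_def by blast
  qed
  have surj: "\<exists>css\<in>link_traces D. R css css'" if css: "css' \<in> link_traces D'" for css'
  proof -
    obtain c p' d zs us where *: "css' = c @ p' @ d" "trace [] B c zs" "trace zs P' p' us" "trace us A d []"
      using css unfolding link_traces_def D'(2) mem_Collect_eq trace_append3 by blast
    then obtain p where "trace zs P p us" using P[OF zs] by blast
    with * have "R (c @ p @ d) css'" "trace [] D (c @ p @ d) []"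
      unfolding D(2) trace_append3 R_def by blast+
    then show ?thesis unfolding link_traces_def by blast
  qed
  have right_unique: "css1 = css2" if R: "R css css1" "R css css2" for css css1 css2
  proof -
    from R obtain c1 p1 q1 d1 zs1 us1 c2 p2 q2 d2 zs2 us2 where
      *: "css = c1 @ p1 @ d1" "css1 = c1 @ q1 @ d1" "trace [] B c1 zs1" "trace zs1 P p1 us1"
         "trace zs1 P' q1 us1" "trace us1 A d1 []"
         "css = c2 @ p2 @ d2" "css2 = c2 @ q2 @ d2" "trace [] B c2 zs2" "trace zs2 P p2 us2"
         "trace zs2 P' q2 us2" "trace us2 A d2 []"
      unfolding R_def by blast
    have "length c1 = length c2" "length p1 = length p2"
      using *(3,4,9,10) by (auto dest!: trace_length)
    then have cpd: "c1 = c2" "p1 = p2" "d1 = d2" using *(1,7) by auto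
    then have "zs1 = zs2" using *(3,9) trace_end by blast
    with cpd have "us1 = us2" using *(4,10) trace_end by blast
    with \<open>zs1 = zs2\<close> have "q1 = q2"
      using *(5,11) P[OF zs[OF *(3)], of us1] by (auto simp: Uniq_def)
    with cpd show ?thesis using *(2,8) by simp
  qed
  have left_unique: "css1 = css2" if R: "R css1 css" "R css2 css" for css css1 css2
  proof -
    from R obtain c1 p1 q1 d1 zs1 us1 c2 p2 q2 d2 zs2 us2 where
      *: "css1 = c1 @ p1 @ d1" "css = c1 @ q1 @ d1" "trace [] B c1 zs1" "trace zs1 P p1 us1"
         "trace zs1 P' q1 us1" "trace us1 A d1 []"
         "css2 = c2 @ p2 @ d2" "css = c2 @ q2 @ d2" "trace [] B c2 zs2" "trace zs2 P p2 us2"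
         "trace zs2 P' q2 us2" "trace us2 A d2 []"
      unfolding R_def by blast
    have "length c1 = length c2" "length q1 = length q2"
      using *(3,5,9,11) by (auto dest!: trace_length)
    then have cpd: "c1 = c2" "q1 = q2" "d1 = d2" using *(2,8) by auto
    then have "zs1 = zs2" using *(3,9) trace_end by blast
    with cpd have "us1 = us2" using *(5,11) trace_end by blast
    with \<open>zs1 = zs2\<close> have "p1 = p2"
      using *(4,10) P[OF zs[OF *(3)], of us1] by (auto simp: Uniq_def)
    with cpd show ?thesis using *(1,7) by simp
  qed
  obtain f where f: "bij_betw f (link_traces D) (link_traces D')" "\<And>css. css \<in> link_traces D \<Longrightarrow> R css (f css)"
    using bij_betw_of_relation[of "link_traces D" "link_traces D'" R] total surj right_unique left_unique
    by blast
  have "f (map (map \<sigma>) css) = map (map \<sigma>) (f css)"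
    if css: "css \<in> link_traces D" and \<sigma>: "\<sigma> \<in> quandle_endomorphisms X tri" for css \<sigma>
  proof -
    have "R (map (map \<sigma>) css) (map (map \<sigma>) (f css))"
    proof -
      obtain c p p' d zs us where *: "css = c @ p @ d" "f css = c @ p' @ d"
        "trace [] B c zs" "trace zs P p us" "trace zs P' p' us" "trace us A d []"
        using f(2)[OF css] unfolding R_def by blast
      show ?thesis
        unfolding *(2) unfolding R_def *(1) map_append
        by (rule exI[of _ "map (map \<sigma>) c"], rule exI[of _ "map (map \<sigma>) p"],
            rule exI[of _ "map (map \<sigma>) p'"], rule exI[of _ "map (map \<sigma>) d"],
            rule exI[of _ "map \<sigma> zs"], rule exI[of _ "map \<sigma> us"])
           (use *(3-6)[THEN trace_endo[OF \<sigma>]] in simp)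
    qed
    moreover have "map (map \<sigma>) css \<in> link_traces D"
      using css trace_endo[OF \<sigma>, of "[]" D css "[]"] by (simp add: link_traces_def)
    ultimately show ?thesis using f(2) right_unique by blast
  qed
  moreover have "trace_weight \<phi> [] D' (f css) = trace_weight \<phi> [] D css"
    if css: "css \<in> link_traces D" and \<phi>: "\<phi> \<in> C" for css \<phi>
  proof -
    obtain c p p' d zs us where *: "css = c @ p @ d" "f css = c @ p' @ d"
      "trace [] B c zs" "trace zs P p us" "trace zs P' p' us" "trace us A d []"
      using f(2)[OF css] unfolding R_def by blast
    then have "trace_weight \<phi> zs P p = trace_weight \<phi> zs P' p'"
      using P[OF zs[OF *(3)], of us] \<phi> by blast
    then show ?thesis
      unfolding *(2) unfolding *(1) D(2) D'(2)
      by (simp only: trace_weight_append[OF *(3)] trace_weight_append[OF *(4)]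
          trace_weight_append[OF *(5)])
  qed
  ultimately show ?thesis using f(1) by blast
qed

end

section \<open>Values of cocycles on chains\<close>

lemma sum_constant_lessThan_add:
  fixes a :: "'a::ab_group_add" and p q :: nat
  shows "(\<Sum>i<p + q. a) = (\<Sum>i<p. a) + (\<Sum>i<q. a)"
  by (induction q) (simp_all add: add.assoc)

lemma int_scale_diff: "int_scale (int m - int n) a = (\<Sum>i<m. a) - (\<Sum>i<n. a)"
proof (cases "n \<le> m")
  case True
  then show ?thesis
    using sum_constant_lessThan_add[where a = a and p = "m - n" and q = n] by (simp add: int_scale_def nat_diff_distrib)
next
  case False
  then show ?thesis
    using sum_constant_lessThan_add[where a = a and p = "n - m" and q = m] by (simp add: int_scale_def nat_diff_distrib)
qed

lemma int_scale_add: "int_scale (m + n) a = int_scale m a + int_scale n a"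
proof -
  obtain p q r s where "m = int p - int q" "n = int r - int s"
    by (metis int_diff_cases)
  moreover from this have "m + n = int (p + r) - int (q + s)" by simp
  ultimately show ?thesis
    by (simp only: int_scale_diff sum_constant_lessThan_add) (simp add: algebra_simps)
qed

lemma int_scale_simps [simp]:
  "int_scale 0 a = 0" "int_scale 1 a = a" "int_scale (- 1) a = - a"
  by (simp_all add: int_scale_def)

text \<open>The linear extension of \<open>\<phi>\<close> to the free abelian group, as it occurs in \<open>cocycle_value\<close>.\<close>

definition chain_value :: "('p \<Rightarrow> 'a::ab_group_add) \<Rightarrow> ('p \<Rightarrow>\<^sub>0 int) \<Rightarrow> 'a" where
  "chain_value \<phi> c = (\<Sum>p\<in>Poly_Mapping.keys c. int_scale (Poly_Mapping.lookup c p) (\<phi> p))"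

lemma chain_value_superset:
  "\<lbrakk>finite K; Poly_Mapping.keys c \<subseteq> K\<rbrakk> \<Longrightarrow>
   chain_value \<phi> c = (\<Sum>p\<in>K. int_scale (Poly_Mapping.lookup c p) (\<phi> p))"
  unfolding chain_value_def
  by (rule sum.mono_neutral_left) (auto simp: in_keys_iff)

lemma chain_value_add: "chain_value \<phi> (c + d) = chain_value \<phi> c + chain_value \<phi> d"
proof -
  let ?K = "Poly_Mapping.keys c \<union> Poly_Mapping.keys d"
  have "chain_value \<phi> e = (\<Sum>p\<in>?K. int_scale (Poly_Mapping.lookup e p) (\<phi> p))"
    if "Poly_Mapping.keys e \<subseteq> ?K" for e
    using that by (intro chain_value_superset) auto
  then show ?thesis
    using Poly_Mapping.keys_add[of c d] by (simp add: lookup_add int_scale_add sum.distrib)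
qed

lemma chain_value_0 [simp]: "chain_value \<phi> 0 = 0"
  by (simp add: chain_value_def)

lemma chain_value_uminus: "chain_value \<phi> (- c) = - chain_value \<phi> c"
  using chain_value_add[of \<phi> c "- c"] by (simp add: minus_unique)

lemma chain_value_sum: "chain_value \<phi> (\<Sum>i\<in>I. c i) = (\<Sum>i\<in>I. chain_value \<phi> (c i))"
  by (induction I rule: infinite_finite_induct) (simp_all add: chain_value_add)

lemma chain_value_cmul_of: "chain_value \<phi> (frag_cmul n (frag_of p)) = int_scale n (\<phi> p)"
  using chain_value_superset[of "{p}" "frag_cmul n (frag_of p)" \<phi>] keys_cmul[of n "frag_of p"]
  by simp

lemma chain_value_degenerate:
  assumes "\<phi> \<in> quandle_2cocycles X tri" "h \<in> degenerate_chains X"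
  shows "chain_value \<phi> h = 0"
proof -
  have *: "chain_value \<phi> (frag_of (x, x)) = 0" if "x \<in> X" for x
    using assms(1) that chain_value_cmul_of[of \<phi> 1 "(x, x)"] by (simp add: quandle_2cocycles_def)
  show ?thesis
    using assms(2) unfolding degenerate_chains_def
    by (induction rule: generate.induct) (auto simp: * chain_value_add chain_value_uminus)
qed

lemma C2Q_class_eq: "C2Q_class X c = (\<lambda>h. h + c) ` degenerate_chains X"
  by (auto simp: C2Q_class_def r_coset_def)

lemma degenerate_chains_subgroup: "subgroup (degenerate_chains X) (free_Abelian_group (X \<times> X))"
  unfolding degenerate_chains_def
  by (rule group.generate_is_subgroup) auto

lemma degenerate_chains_zero: "0 \<in> degenerate_chains X"
  using subgroup.one_closed[OF degenerate_chains_subgroup] by simp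

lemma degenerate_chains_add:
  "g \<in> degenerate_chains X \<Longrightarrow> h \<in> degenerate_chains X \<Longrightarrow> g + h \<in> degenerate_chains X"
  using subgroup.m_closed[OF degenerate_chains_subgroup] by simp

lemma degenerate_chains_uminus:
  "h \<in> degenerate_chains X \<Longrightarrow> - h \<in> degenerate_chains X"
  using subgroup.m_inv_closed[OF degenerate_chains_subgroup, of h X]
    subgroup.mem_carrier[OF degenerate_chains_subgroup, of h X] by simp

lemma C2Q_class_add_degenerate:
  assumes "h \<in> degenerate_chains X"
  shows "C2Q_class X (h + c) = C2Q_class X c"
proof (rule antisym)
  show "C2Q_class X (h + c) \<subseteq> C2Q_class X c"
    using assms degenerate_chains_add by (auto simp: C2Q_class_eq add.assoc[symmetric])
  show "C2Q_class X c \<subseteq> C2Q_class X (h + c)"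
  proof
    fix d assume "d \<in> C2Q_class X c"
    then obtain g where "g \<in> degenerate_chains X" "d = g + c" by (auto simp: C2Q_class_eq)
    then have "g - h \<in> degenerate_chains X" "d = (g - h) + (h + c)"
      using assms degenerate_chains_add[of g X "- h"] by (simp_all add: degenerate_chains_uminus)
    then show "d \<in> C2Q_class X (h + c)" unfolding C2Q_class_eq by (intro image_eqI)
  qed
qed

text \<open>A cocycle vanishes on the degenerate chains, so its extension is constant on their cosets, and
  \<open>the_elem\<close> returns this constant.\<close>

lemma cocycle_value_class:
  assumes "\<phi> \<in> quandle_2cocycles X tri"
  shows "cocycle_value \<phi> (C2Q_class X c) = chain_value \<phi> c"
proof -
  have "(chain_value \<phi>) ` C2Q_class X c = {chain_value \<phi> c}"
    using degenerate_chains_zero[of X] chain_value_degenerate[OF assms]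
    by (auto simp: C2Q_class_eq chain_value_add image_image intro!: image_eqI)
  then show ?thesis
    unfolding cocycle_value_def chain_value_def[symmetric] by simp
qed

definition apply_endo :: "('x \<Rightarrow> 'x) \<Rightarrow> ('x \<times> 'x \<Rightarrow>\<^sub>0 int) \<Rightarrow> ('x \<times> 'x \<Rightarrow>\<^sub>0 int)" where
  "apply_endo \<sigma> = frag_extend (\<lambda>(x, y). frag_of (\<sigma> x, \<sigma> y))"

lemma apply_endo_degenerate:
  assumes "\<sigma> ` X \<subseteq> X" "h \<in> degenerate_chains X"
  shows "apply_endo \<sigma> h \<in> degenerate_chains X"
proof -
  have gen: "frag_of (\<sigma> x, \<sigma> x) \<in> degenerate_chains X" if "x \<in> X" for x
    using assms(1) that unfolding degenerate_chains_def by (auto intro: generate.incl)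
  show ?thesis
    using assms(2)[unfolded degenerate_chains_def]
  proof (induction rule: generate.induct)
    case one
    then show ?case by (simp add: apply_endo_def degenerate_chains_zero)
  next
    case (incl h)
    then show ?case using gen by (auto simp: apply_endo_def)
  next
    case (inv h)
    then show ?case using gen
      by (auto simp: apply_endo_def frag_extend_minus degenerate_chains_uminus)
  next
    case (eng h1 h2)
    then show ?case by (simp add: apply_endo_def frag_extend_add degenerate_chains_add)
  qed
qed

text \<open>An endomorphism maps degenerate chains to degenerate chains, so the cosets of the images of all
  representatives coincide.\<close>

lemma endo_chain_class:
  assumes "\<sigma> ` X \<subseteq> X"
  shows "endo_chain X \<sigma> (C2Q_class X c) = C2Q_class X (apply_endo \<sigma> c)"
proof -
  have "(\<lambda>d. C2Q_class X (apply_endo \<sigma> d)) ` C2Q_class X c = {C2Q_class X (apply_endo \<sigma> c)}"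
    (is "?f ` _ = _")
  proof -
    have "?f (h + c) = ?f c" if "h \<in> degenerate_chains X" for h
      using C2Q_class_add_degenerate[OF apply_endo_degenerate[OF assms that]]
      by (simp add: apply_endo_def frag_extend_add)
    then show ?thesis
      using degenerate_chains_zero[of X] by (auto simp: C2Q_class_eq[of X c] image_image)
  qed
  then show ?thesis
    by (simp add: endo_chain_def apply_endo_def)
qed

section \<open>Colorings of a link diagram as traces\<close>

context quandle_with_cocycles
begin

lemma trace_iff_nth:
  "length css = length T \<Longrightarrow> trace xs T css ys \<longleftrightarrow>
     (\<forall>i<length T. slice_rel (T ! i) ((xs # css) ! i) (css ! i)) \<and> ys = last (xs # css)"
proof (induction T arbitrary: xs css)
  case (Cons s T)
  then obtain zs css' where css: "css = zs # css'" "length css' = length T"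
    by (cases css) auto
  have "(\<forall>i<length (s # T). slice_rel ((s # T) ! i) ((xs # css) ! i) (css ! i)) \<longleftrightarrow>
    slice_rel s xs zs \<and> (\<forall>i<length T. slice_rel (T ! i) ((zs # css') ! i) (css' ! i))"
    unfolding css(1) length_Cons All_less_Suc2 by simp
  then show ?case
    using Cons.IH[OF css(2), of zs] css(1) by simp
qed auto

lemma trace_weight_nth:
  "length css = length T \<Longrightarrow>
   trace_weight \<phi> xs T css = (\<Sum>i<length T. slice_weight \<phi> (T ! i) ((xs # css) ! i))"
proof (induction T arbitrary: xs css)
  case (Cons s T)
  then obtain zs css' where "css = zs # css'" "length css' = length T"
    by (cases css) auto
  then show ?case
    using Cons.IH[of css' zs] by (simp add: sum.lessThan_Suc_shift del: sum.lessThan_Suc)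
qed simp

lemma tangle_diagram_nth:
  "tangle_diagram a T b \<Longrightarrow> i < length T \<Longrightarrow>
   top (T ! i) = (if Suc i < length T then bottom (T ! Suc i) else b)"
proof (induction T arbitrary: a i)
  case (Cons s T)
  show ?case
  proof (cases i)
    case 0
    then show ?thesis using Cons.prems by (cases T) auto
  next
    case (Suc j)
    then show ?thesis using Cons.IH[of "top s" j] Cons.prems by auto
  qed
qed simp

text \<open>The value \<open>0\<close> at \<open>length D\<close> is the number of points on the line above the last slice of a link
  diagram.\<close>

definition width :: "slice list \<Rightarrow> nat \<Rightarrow> nat" where
  "width D i = (if i < length D then length (bottom (D ! i)) else 0)"

definition row :: "slice list \<Rightarrow> ((nat \<times> nat) set \<Rightarrow> 'x) \<Rightarrow> nat \<Rightarrow> 'x list" where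
  "row D v i = map (\<lambda>j. v (arc_at D (i, j))) [0..<width D i]"

text \<open>The row below the whole diagram is empty and is left out, as in the third argument of \<open>trace\<close>.\<close>

definition rows :: "slice list \<Rightarrow> ((nat \<times> nat) set \<Rightarrow> 'x) \<Rightarrow> 'x list list" where
  "rows D v = map (row D v) [1..<Suc (length D)]"

lemma points_iff_width: "(i, j) \<in> points D \<longleftrightarrow> j < width D i"
  by (simp add: points_def width_def)

lemma width_Suc:
  "link_diagram D \<Longrightarrow> i < length D \<Longrightarrow> width D (Suc i) = length (top (D ! i))"
  using tangle_diagram_nth[of "[]" D "[]" i] by (auto simp: link_diagram_def width_def)

lemma width_0: "link_diagram D \<Longrightarrow> width D 0 = 0"
  by (cases D) (auto simp: link_diagram_def width_def)

lemma rows_nth: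
  assumes "link_diagram D" "i \<le> length D"
  shows "([] # rows D v) ! i = row D v i"
proof (cases i)
  case 0
  then show ?thesis using width_0[OF assms(1)] by (simp add: row_def)
next
  case (Suc k)
  then show ?thesis using assms(2) by (simp add: rows_def del: upt_Suc)
qed

lemma last_rows: "last ([] # rows D v) = []"
  by (simp add: rows_def row_def width_def)

lemma arc_at_joined: "joined D p q \<Longrightarrow> arc_at D p = arc_at D q"
proof -
  assume "joined D p q"
  then have pq: "equivclp (joined D) p q" by blast
  show "arc_at D p = arc_at D q"
    unfolding arc_at_def using pq equivclp_trans[OF pq] equivclp_trans[OF equivclp_sym[OF pq]] by blast
qed

lemma crossing_slice:
  assumes "i \<in> classical_crossings D"
  obtains l k d1 d2 r where "i < length D" "D ! i = Slice l (Cross k d1 d2) r" "k \<noteq> Virt"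
proof -
  from assms obtain k d1 d2 where "i < length D" "tile_of (D ! i) = Cross k d1 d2" "k \<noteq> Virt"
    by (auto simp: classical_crossings_def)
  then show thesis
    using that[of "left_of (D ! i)" k d1 d2 "right_of (D ! i)"] by (metis slice.collapse)
qed

lemma crossing_points:
  assumes D: "link_diagram D" and i: "i < length D" and s: "D ! i = Slice l (Cross k d1 d2) r"
  shows "(i, length l) \<in> points D" "(i, Suc (length l)) \<in> points D"
    "(Suc i, length l) \<in> points D" "(Suc i, Suc (length l)) \<in> points D"
  using i s width_Suc[OF D i] unfolding points_iff_width
  by (auto simp: width_def bottom_def top_def split: if_splits)

lemma arc_in_diagram_arcs: "p \<in> points D \<Longrightarrow> arc_at D p \<in> diagram_arcs D"
  by (simp add: diagram_arcs_def)

lemma crossing_arcs: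
  assumes "link_diagram D" "i \<in> classical_crossings D"
  shows "over_arc D i \<in> diagram_arcs D" "right_under_arc D i \<in> diagram_arcs D"
    "left_under_arc D i \<in> diagram_arcs D"
proof -
  obtain l k d1 d2 r where s: "i < length D" "D ! i = Slice l (Cross k d1 d2) r" "k \<noteq> Virt"
    using crossing_slice[OF assms(2)] .
  note * = crossing_points[OF assms(1) s(1,2)]
  show "over_arc D i \<in> diagram_arcs D" "right_under_arc D i \<in> diagram_arcs D"
    "left_under_arc D i \<in> diagram_arcs D"
    using s(2,3) * by (cases k; simp add: arc_at_crossing_def arc_in_diagram_arcs)+
qed

text \<open>The coloring condition is stated from the right to the left of the over-strand, the condition on
  traces from the bottom to the top. They differ by inverting the action if the bottom end of
  the under-strand lies on the left of the over-strand. The map \<open>c\<close> gives the colors at the four ends of the crossing,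
  with first coordinate \<open>0\<close> at the bottom.\<close>

lemma crossing_relation_iff:
  assumes "k \<noteq> Virt" "c (0, m) \<in> X" "c (0, Suc m) \<in> X" "c (1, m) \<in> X" "c (1, Suc m) \<in> X"
    and over: "k = OverNE \<Longrightarrow> c (1, Suc m) = c (0, m)" "k = OverNW \<Longrightarrow> c (1, m) = c (0, Suc m)"
  shows "c (left_pos m (Cross k d1 d2)) = tri (c (right_pos m (Cross k d1 d2))) (c (over_pos m (Cross k d1 d2)))
    \<longleftrightarrow> tile_rel (Cross k d1 d2) [c (0, m), c (0, Suc m)] [c (1, m), c (1, Suc m)]"
proof -
  have tri_iff: "z = tri x y \<longleftrightarrow> x = pass Down y z" if "x \<in> X" "y \<in> X" "z \<in> X" for x y z
    using tri_pass_Down[of z y] pass_Down_tri[of x y] that by auto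
  show ?thesis
  proof (cases k)
    case OverNE
    show ?thesis
    proof (cases d1)
      case Up
      then show ?thesis using OverNE over(1) by (auto simp: pass_def)
    next
      case Down
      then show ?thesis using OverNE over(1) assms(2-5) tri_iff by auto
    qed
  next
    case OverNW
    show ?thesis
    proof (cases d2)
      case Up
      then show ?thesis using OverNW over(2) assms(2-5) tri_iff by auto
    next
      case Down
      then show ?thesis using OverNW over(2) by (auto simp: pass_def)
    qed
  qed (use assms(1) in simp)
qed

lemma crossing_weight_eq:
  assumes "k \<noteq> Virt" "c (0, m) \<in> X" "c (0, Suc m) \<in> X" "c (1, m) \<in> X" "c (1, Suc m) \<in> X"
    and "tile_rel (Cross k d1 d2) [c (0, m), c (0, Suc m)] [c (1, m), c (1, Suc m)]"
  shows "int_scale (tile_sign (Cross k d1 d2))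
      (\<phi> (c (right_pos m (Cross k d1 d2)), c (over_pos m (Cross k d1 d2)))) =
    tile_weight \<phi> (Cross k d1 d2) [c (0, m), c (0, Suc m)]"
  using assms by (cases k; cases d1; cases d2) (auto simp: pass_weight_def)

lemma map_upt_add: "map f [0..<a + b] = map f [0..<a] @ map (\<lambda>j. f (a + j)) [0..<b]"
  by (rule nth_equalityI) (auto simp: nth_append)

lemma slice_rel_split:
  assumes "length ls = length l" "length rs = length r" "set (ls @ bs @ rs) \<subseteq> X" "set (ls @ ts @ rs) \<subseteq> X"
  shows "slice_rel (Slice l t r) (ls @ bs @ rs) (ls @ ts @ rs) \<longleftrightarrow> tile_rel t bs ts"
proof
  assume "slice_rel (Slice l t r) (ls @ bs @ rs) (ls @ ts @ rs)"
  then obtain ls' bs' ts' rs' where *: "ls @ bs @ rs = ls' @ bs' @ rs'" "ls @ ts @ rs = ls' @ ts' @ rs'"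
    "tile_rel t bs' ts'" "length ls' = length l" "length rs' = length r"
    unfolding slice_rel_def slice.sel by blast
  have "ls = ls'" using *(1,4) assms(1) by simp
  then have "bs = bs'" "ts = ts'" using *(1,2,5) assms(2) by simp_all
  then show "tile_rel t bs ts" using *(3) by simp
next
  assume "tile_rel t bs ts"
  then show "slice_rel (Slice l t r) (ls @ bs @ rs) (ls @ ts @ rs)"
    unfolding slice_rel_def using assms by auto
qed

lemma row_subset:
  assumes "v \<in> diagram_arcs D \<rightarrow> X"
  shows "set (row D v i) \<subseteq> X"
  using assms by (auto simp: row_def points_iff_width[symmetric] arc_in_diagram_arcs)

text \<open>Points joined inside a slice lie on one arc, so the values of \<open>v\<close> on arcs satisfy all conditions of
  the slice automatically, except the one for the under-strand of a classical crossing.\<close>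

lemma slice_rel_rows_iff:
  assumes D: "link_diagram D" and v: "v \<in> diagram_arcs D \<rightarrow> X" and i: "i < length D"
  shows "slice_rel (D ! i) (row D v i) (row D v (Suc i)) \<longleftrightarrow>
    (i \<in> classical_crossings D \<longrightarrow>
       v (left_under_arc D i) = tri (v (right_under_arc D i)) (v (over_arc D i)))"
proof -
  obtain l t r where s: "D ! i = Slice l t r" by (cases "D ! i")
  define c where "c = (\<lambda>(h, j). v (arc_at D (i + h, j)))"
  define ls where "ls = map (\<lambda>j. c (0, j)) [0..<length l]"
  define rs where "rs = map (\<lambda>j. c (0, length l + length (tile_bottom t) + j)) [0..<length r]"
  define bs where "bs = map (\<lambda>j. c (0, length l + j)) [0..<length (tile_bottom t)]"
  define ts where "ts = map (\<lambda>j. c (1, length l + j)) [0..<length (tile_top t)]"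
  have "row D v i = map (\<lambda>j. c (0, j)) [0..<length l + (length (tile_bottom t) + length r)]"
    using i s by (simp add: row_def width_def bottom_def c_def)
  then have row_i: "row D v i = ls @ bs @ rs"
    unfolding map_upt_add ls_def bs_def rs_def by (simp add: add.assoc)
  have left: "c (1, j) = c (0, j)" if "j < length l" for j
    using arc_at_joined[OF joined.left_strand[OF i s that]] by (simp add: c_def)
  have right: "c (1, length l + length (tile_top t) + j) = c (0, length l + length (tile_bottom t) + j)"
    if "j < length r" for j
    using arc_at_joined[OF joined.right_strand[OF i s that]] by (simp add: c_def)
  have "row D v (Suc i) = map (\<lambda>j. c (1, j)) [0..<length l + (length (tile_top t) + length r)]"
    using s by (simp add: row_def width_Suc[OF D i] top_def c_def)
  moreover have "map (\<lambda>j. c (1, j)) [0..<length l] = ls"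
    using left by (simp add: ls_def)
  moreover have "map (\<lambda>j. c (1, length l + (length (tile_top t) + j))) [0..<length r] = rs"
    using right by (simp add: rs_def add.assoc)
  ultimately have row_Suc: "row D v (Suc i) = ls @ ts @ rs"
    unfolding map_upt_add ts_def by simp
  have set: "set (ls @ bs @ rs) \<subseteq> X" "set (ls @ ts @ rs) \<subseteq> X"
    using row_subset[OF v, of i] row_subset[OF v, of "Suc i"] unfolding row_i row_Suc by auto
  have rel: "slice_rel (D ! i) (row D v i) (row D v (Suc i)) \<longleftrightarrow> tile_rel t bs ts"
    unfolding s row_i row_Suc by (rule slice_rel_split[OF _ _ set]) (simp_all add: ls_def rs_def)
  show ?thesis
  proof (cases t)
    case (Cup d)
    have "c (1, length l) = c (1, Suc (length l))"
      using arc_at_joined[OF joined.cup[OF i s[unfolded Cup]]] by (simp add: c_def)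
    then show ?thesis
      unfolding rel using s Cup by (simp add: bs_def ts_def classical_crossings_def upt_rec)
  next
    case (Cap d)
    have "c (0, length l) = c (0, Suc (length l))"
      using arc_at_joined[OF joined.cap[OF i s[unfolded Cap]]] by (simp add: c_def)
    then show ?thesis
      unfolding rel using s Cap by (simp add: bs_def ts_def classical_crossings_def upt_rec)
  next
    case (Cross k d1 d2)
    have bs: "bs = [c (0, length l), c (0, Suc (length l))]"
      and ts: "ts = [c (1, length l), c (1, Suc (length l))]"
      using Cross by (simp_all add: bs_def ts_def upt_rec)
    have NE: "c (0, length l) = c (1, Suc (length l))" if "k \<noteq> OverNW"
      using arc_at_joined[OF joined.cross_NE[OF i s[unfolded Cross] that]] by (simp add: c_def)
    have NW: "c (0, Suc (length l)) = c (1, length l)" if "k \<noteq> OverNE"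
      using arc_at_joined[OF joined.cross_NW[OF i s[unfolded Cross] that]] by (simp add: c_def)
    have arc: "v (arc_at_crossing pos D i) = c (pos (length l) (Cross k d1 d2))" for pos
      using s Cross by (simp add: arc_at_crossing_def c_def split: prod.split)
    show ?thesis
    proof (cases "k = Virt")
      case True
      then show ?thesis
        unfolding rel bs ts using s Cross NE NW by (simp add: classical_crossings_def)
    next
      case False
      then have "i \<in> classical_crossings D"
        using i s Cross by (simp add: classical_crossings_def)
      moreover have "c (0, length l) \<in> X" "c (0, Suc (length l)) \<in> X" "c (1, length l) \<in> X"
          "c (1, Suc (length l)) \<in> X"
        using set bs ts by auto
      ultimately show ?thesis
        unfolding rel unfolding bs ts Cross arc
        using crossing_relation_iff[of k c "length l" d1 d2] False NE NW by simp
    qed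
  qed
qed

lemma crossing_weight_rows:
  assumes D: "link_diagram D" and v: "v \<in> colorings X tri D" and i: "i \<in> classical_crossings D"
  shows "int_scale (tile_sign (tile_of (D ! i))) (\<phi> (v (right_under_arc D i), v (over_arc D i))) =
    slice_weight \<phi> (D ! i) (row D v i)"
proof -
  obtain l k d1 d2 r where s: "i < length D" "D ! i = Slice l (Cross k d1 d2) r" "k \<noteq> Virt"
    using crossing_slice[OF i] .
  define c where "c = (\<lambda>(h, j). v (arc_at D (i + h, j)))"
  have arc: "v (arc_at_crossing pos D i) = c (pos (length l) (Cross k d1 d2))" for pos
    using s by (simp add: arc_at_crossing_def c_def split: prod.split)
  note points = crossing_points[OF D s(1,2)]
  have X: "c (0, length l) \<in> X" "c (0, Suc (length l)) \<in> X" "c (1, length l) \<in> X"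
      "c (1, Suc (length l)) \<in> X"
    using v points[THEN arc_in_diagram_arcs] by (auto simp: colorings_def c_def)
  have NE: "c (0, length l) = c (1, Suc (length l))" if "k \<noteq> OverNW"
    using arc_at_joined[OF joined.cross_NE[OF s(1,2) that]] by (simp add: c_def)
  have NW: "c (0, Suc (length l)) = c (1, length l)" if "k \<noteq> OverNE"
    using arc_at_joined[OF joined.cross_NW[OF s(1,2) that]] by (simp add: c_def)
  have "c (left_pos (length l) (Cross k d1 d2)) =
      tri (c (right_pos (length l) (Cross k d1 d2))) (c (over_pos (length l) (Cross k d1 d2)))"
    using v i unfolding colorings_def arc[symmetric] by simp
  then have rel: "tile_rel (Cross k d1 d2) [c (0, length l), c (0, Suc (length l))]
      [c (1, length l), c (1, Suc (length l))]"
    using crossing_relation_iff[of k c "length l" d1 d2] s(3) X NE NW by simp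
  have width: "width D i = length l + (2 + length r)"
    using s by (simp add: width_def bottom_def)
  have "take 2 (drop (length l) (row D v i)) = [c (0, length l), c (0, Suc (length l))]"
    unfolding row_def width map_upt_add by (simp add: c_def upt_conv_Cons)
  then have "slice_weight \<phi> (D ! i) (row D v i) =
      tile_weight \<phi> (Cross k d1 d2) [c (0, length l), c (0, Suc (length l))]"
    using s by (simp add: slice_weight_def numeral_2_eq_2)
  then show ?thesis
    unfolding arc using crossing_weight_eq[OF s(3) X rel] s by simp
qed

lemma link_traces_states:
  assumes D: "link_diagram D" and css: "css \<in> link_traces D" and i: "i \<le> length D"
  shows "length (([] # css) ! i) = width D i" "set (([] # css) ! i) \<subseteq> X"
proof -
  have tr: "trace [] D css []" using css by (simp add: link_traces_def)
  note len = trace_length[OF tr]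
  have rel: "slice_rel (D ! j) (([] # css) ! j) (css ! j)" if "j < length D" for j
    using tr that unfolding trace_iff_nth[OF len] by blast
  show "set (([] # css) ! i) \<subseteq> X"
    using slice_rel_set[OF rel] i by (cases i) auto
  show "length (([] # css) ! i) = width D i"
    using slice_rel_length[OF rel] width_0[OF D] width_Suc[OF D] i by (cases i) auto
qed

text \<open>The converse: a trace has the same color at joined points, so it gives well-defined colors of arcs.\<close>

lemma link_traces_joined:
  assumes css: "css \<in> link_traces D" and "joined D p q"
  shows "([] # css) ! fst p ! snd p = ([] # css) ! fst q ! snd q"
proof -
  have tr: "trace [] D css []" using css by (simp add: link_traces_def)
  have rel: "\<exists>ls bs ts rs. ([] # css) ! i = ls @ bs @ rs \<and> css ! i = ls @ ts @ rs \<and> tile_rel t bs ts \<and>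
      length ls = length l \<and> length rs = length r"
    if "i < length D" "D ! i = Slice l t r" for i l t r
    using tr that unfolding trace_iff_nth[OF trace_length[OF tr]] slice_rel_def by (metis slice.sel)
  show ?thesis
    using assms(2)
  proof cases
    case (left_strand i l t r j)
    then show ?thesis using rel[OF left_strand(3,4)] by (auto simp: nth_append)
  next
    case (right_strand i l t r j)
    then show ?thesis
      using rel[OF right_strand(3,4)] by (auto simp: nth_append dest!: tile_rel_length)
  next
    case (cup i l d r)
    then show ?thesis using rel[OF cup(3,4)] by (auto simp: nth_append)
  next
    case (cap i l d r)
    then show ?thesis using rel[OF cap(3,4)] by (auto simp: nth_append)
  next
    case (cross_NE i l k d1 d2 r)
    then show ?thesis using rel[OF cross_NE(3,4)] by (cases k) (auto simp: nth_append)
  next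
    case (cross_NW i l k d1 d2 r)
    then show ?thesis using rel[OF cross_NW(3,4)] by (cases k) (auto simp: nth_append)
  qed
qed

lemma rows_bij:
  assumes D: "link_diagram D"
  shows "bij_betw (rows D) (colorings X tri D) (link_traces D)"
proof (rule bij_betw_imageI)
  have len: "length (rows D v) = length D" for v by (simp add: rows_def del: upt_Suc)
  have trace_rows: "trace [] D (rows D v) [] \<longleftrightarrow> (\<forall>i<length D. slice_rel (D ! i) (row D v i) (row D v (Suc i)))" for v
  proof -
    have "([] # rows D v) ! i = row D v i" "rows D v ! i = row D v (Suc i)" if "i < length D" for i
      using rows_nth[OF D, of i v] rows_nth[OF D, of "Suc i" v] that by simp_all
    then show ?thesis unfolding trace_iff_nth[OF len] last_rows by simp
  qed
  have coloring_iff: "v \<in> colorings X tri D \<longleftrightarrow> rows D v \<in> link_traces D"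
    if "v \<in> diagram_arcs D \<rightarrow>\<^sub>E X" for v
  proof -
    have "v \<in> diagram_arcs D \<rightarrow> X" using that by blast
    then show ?thesis
      using that slice_rel_rows_iff[OF D] unfolding link_traces_def mem_Collect_eq trace_rows colorings_def
      by (auto simp: classical_crossings_def)
  qed
  show "inj_on (rows D) (colorings X tri D)"
  proof (rule inj_onI)
    fix v w assume v: "v \<in> colorings X tri D" and w: "w \<in> colorings X tri D" and eq: "rows D v = rows D w"
    have "v (arc_at D (i, j)) = w (arc_at D (i, j))" if "(i, j) \<in> points D" for i j
    proof -
      have "row D v i = row D w i"
        using rows_nth[OF D, of i] eq that by (simp add: points_def) (metis less_imp_le_nat)
      then show ?thesis using that by (simp add: row_def points_iff_width)
    qed
    moreover have "v \<in> diagram_arcs D \<rightarrow>\<^sub>E X" "w \<in> diagram_arcs D \<rightarrow>\<^sub>E X"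
      using v w by (simp_all add: colorings_def)
    ultimately show "v = w"
      by (intro PiE_ext) (auto simp: diagram_arcs_def)
  qed
  show "rows D ` colorings X tri D = link_traces D"
  proof
    show "rows D ` colorings X tri D \<subseteq> link_traces D"
      using coloring_iff by (auto simp: colorings_def)
    show "link_traces D \<subseteq> rows D ` colorings X tri D"
    proof
      fix css assume css: "css \<in> link_traces D"
      define c where "c p = ([] # css) ! fst p ! snd p" for p
      \<comment> \<open>\<open>c\<close> is constant on arcs, so \<open>the_elem\<close> picks the color of the arc.\<close>
      define v where "v = restrict (\<lambda>A. the_elem (c ` A)) (diagram_arcs D)"
      have const: "c q = c p" if "equivclp (joined D) p q" for p q
        using that by induction (use link_traces_joined[OF css] in \<open>auto simp: c_def\<close>)
      have v_arc: "v (arc_at D p) = c p" if "p \<in> points D" for p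
      proof -
        have "c ` arc_at D p = {c p}"
          using const by (auto simp: arc_at_def intro!: image_eqI[of _ _ p])
        then show ?thesis using that by (simp add: v_def diagram_arcs_def)
      qed
      note states = link_traces_states[OF D css]
      have row: "row D v i = ([] # css) ! i" if "i \<le> length D" for i
        using states(1)[OF that] v_arc[unfolded split_paired_all points_iff_width]
        by (intro nth_equalityI) (simp_all add: row_def points_iff_width c_def)
      have "length css = length D"
        using css trace_length by (auto simp: link_traces_def)
      then have rows: "rows D v = css"
        using row[of "Suc _"] by (intro nth_equalityI) (simp_all add: rows_def del: upt_Suc)
      have "c p \<in> X" if "p \<in> points D" for p
        using states[of "fst p"] that by (cases p) (auto simp: points_iff_width[symmetric] points_def c_def)
      then have "v \<in> diagram_arcs D \<rightarrow>\<^sub>E X"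
        using v_arc by (auto simp: diagram_arcs_def v_def)
      then have "v \<in> colorings X tri D"
        using coloring_iff css rows by simp
      then show "css \<in> rows D ` colorings X tri D" using rows by blast
    qed
  qed
qed

lemma push_coloring_closed:
  assumes D: "link_diagram D" and \<sigma>: "\<sigma> \<in> quandle_endomorphisms X tri" and v: "v \<in> colorings X tri D"
  shows "push_coloring \<sigma> D v \<in> colorings X tri D"
proof -
  have vX: "v A \<in> X" if "A \<in> diagram_arcs D" for A
    using v that by (auto simp: colorings_def)
  then have "push_coloring \<sigma> D v \<in> diagram_arcs D \<rightarrow>\<^sub>E X"
    using \<sigma> by (auto simp: push_coloring_def quandle_endomorphisms_def)
  then show ?thesis
    using v vX \<sigma> crossing_arcs[OF D]
    by (simp add: colorings_def push_coloring_def quandle_endomorphisms_def)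
qed

lemma rows_push: "rows D (push_coloring \<sigma> D v) = map (map \<sigma>) (rows D v)"
proof -
  have "row D (push_coloring \<sigma> D v) i = map \<sigma> (row D v i)" for i
    by (simp add: row_def push_coloring_def points_iff_width[symmetric] arc_in_diagram_arcs)
  then show ?thesis by (simp add: rows_def del: upt_Suc)
qed

definition coloring_chain :: "slice list \<Rightarrow> ((nat \<times> nat) set \<Rightarrow> 'x) \<Rightarrow> ('x \<times> 'x \<Rightarrow>\<^sub>0 int)" where
  "coloring_chain D v = (\<Sum>i\<in>classical_crossings D.
     frag_cmul (tile_sign (tile_of (D ! i))) (frag_of (v (right_under_arc D i), v (over_arc D i))))"

text \<open>Classical crossings contribute their slice weights, and all other slices have weight \<open>0\<close>.\<close>

lemma cocycle_value_coloring_vector: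
  assumes D: "link_diagram D" and v: "v \<in> colorings X tri D" and \<phi>: "\<phi> \<in> C"
  shows "cocycle_value \<phi> (coloring_vector X D v) = trace_weight \<phi> [] D (rows D v)"
proof -
  have "cocycle_value \<phi> (coloring_vector X D v) = chain_value \<phi> (coloring_chain D v)"
    unfolding coloring_vector_def coloring_chain_def[symmetric]
    using cocycle_value_class \<phi> cocycles by blast
  also have "\<dots> = (\<Sum>i\<in>classical_crossings D. slice_weight \<phi> (D ! i) (row D v i))"
    unfolding coloring_chain_def chain_value_sum chain_value_cmul_of
    by (rule sum.cong) (simp_all add: crossing_weight_rows[OF D v])
  also have "\<dots> = (\<Sum>i<length D. slice_weight \<phi> (D ! i) (row D v i))"
  proof (rule sum.mono_neutral_left)
    show "\<forall>i\<in>{..<length D} - classical_crossings D. slice_weight \<phi> (D ! i) (row D v i) = 0"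
    proof
      fix i assume i: "i \<in> {..<length D} - classical_crossings D"
      show "slice_weight \<phi> (D ! i) (row D v i) = 0"
      proof (cases "tile_of (D ! i)")
        case (Cross k d1 d2)
        then have "k = Virt" using i by (auto simp: classical_crossings_def)
        then show ?thesis using Cross by (simp add: slice_weight_def)
      qed (simp_all add: slice_weight_def)
    qed
  qed (auto simp: classical_crossings_def)
  also have "\<dots> = trace_weight \<phi> [] D (rows D v)"
    using rows_nth[OF D, of _ v] by (simp add: trace_weight_nth rows_def[of D v] del: upt_Suc)
  finally show ?thesis .
qed

text \<open>This turns the edge weights into data of colorings: the target of an edge carries the image of the
  coloring vector of its source.\<close>

lemma endo_chain_coloring_vector:
  assumes D: "link_diagram D" and \<sigma>: "\<sigma> \<in> quandle_endomorphisms X tri"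
  shows "endo_chain X \<sigma> (coloring_vector X D v) = coloring_vector X D (push_coloring \<sigma> D v)"
proof -
  have "\<sigma> ` X \<subseteq> X" using \<sigma> by (auto simp: quandle_endomorphisms_def)
  then have "endo_chain X \<sigma> (coloring_vector X D v) = C2Q_class X (apply_endo \<sigma> (coloring_chain D v))"
    by (simp add: coloring_vector_def coloring_chain_def endo_chain_class)
  also have "apply_endo \<sigma> (coloring_chain D v) = coloring_chain D (push_coloring \<sigma> D v)"
    unfolding coloring_chain_def apply_endo_def
    by (subst frag_extend_sum, simp add: classical_crossings_def, rule sum.cong)
       (simp_all add: frag_extend_cmul push_coloring_def crossing_arcs[OF D])
  finally show ?thesis by (simp add: coloring_vector_def coloring_chain_def)
qed

section \<open>Isomorphic quiver representations\<close>

lemma vertex_module_cong: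
  "(\<And>\<phi>. \<phi> \<in> C \<Longrightarrow> cocycle_value \<phi> U = cocycle_value \<phi> U') \<Longrightarrow> vertex_module C U = vertex_module C U'"
  unfolding vertex_module_def by (rule arg_cong[of _ _ "\<lambda>M. left_submodule hull M"]) force

lemma edge_map_cong:
  assumes "\<And>\<phi>. \<phi> \<in> C \<Longrightarrow> cocycle_value \<phi> U = cocycle_value \<phi> U'"
    and "\<And>\<phi>. \<phi> \<in> C \<Longrightarrow> cocycle_value \<phi> (endo_chain X \<sigma> U) = cocycle_value \<phi> (endo_chain X \<sigma> U')"
  shows "edge_map X C U \<sigma> = edge_map X C U' \<sigma>"
  unfolding edge_map_def edge_map_part_def using assms by (intro ext sum.cong) simp_all

text \<open>The bijection of traces is transported to the colorings; edges are mapped with their endomorphism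
  kept.\<close>

lemma quiver_isomorphic_local_equiv:
  assumes S: "S \<subseteq> quandle_endomorphisms X tri" and "local_equiv P P'"
    and D: "link_diagram D" "D = B @ P @ A" and D': "link_diagram D'" "D' = B @ P' @ A"
  shows "quiver_isomorphic (quiver_representation X tri C TYPE('k::ring_1) S D)
           (quiver_representation X tri C TYPE('k) S D')"
proof -
  obtain f where f: "bij_betw f (link_traces D) (link_traces D')"
    and f_endo: "\<And>css \<sigma>. css \<in> link_traces D \<Longrightarrow> \<sigma> \<in> quandle_endomorphisms X tri \<Longrightarrow>
      f (map (map \<sigma>) css) = map (map \<sigma>) (f css)"
    and f_weight: "\<And>css \<phi>. css \<in> link_traces D \<Longrightarrow> \<phi> \<in> C \<Longrightarrow> trace_weight \<phi> [] D' (f css) = trace_weight \<phi> [] D css"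
    using link_traces_bij[OF assms(2) D D'] by blast
  define F where "F = inv_into (colorings X tri D') (rows D') \<circ> f \<circ> rows D"
  note bij = rows_bij[OF D(1)] and bij' = rows_bij[OF D'(1)]
  have F: "bij_betw F (colorings X tri D) (colorings X tri D')"
    unfolding F_def using bij_betw_trans[OF bij bij_betw_trans[OF f bij_betw_inv_into[OF bij']]]
    by (simp add: comp_assoc)
  have rows_D: "rows D v \<in> link_traces D" if "v \<in> colorings X tri D" for v
    using bij that by (auto dest: bij_betwE)
  have rows_F: "rows D' (F v) = f (rows D v)" if "v \<in> colorings X tri D" for v
    using rows_D[OF that] f bij' unfolding F_def
    by (simp add: bij_betw_inv_into_right bij_betw_apply)
  have F_in: "F v \<in> colorings X tri D'" if "v \<in> colorings X tri D" for v
    using F that by (rule bij_betw_apply)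
  have F_push: "F (push_coloring \<sigma> D v) = push_coloring \<sigma> D' (F v)"
    if v: "v \<in> colorings X tri D" and \<sigma>: "\<sigma> \<in> quandle_endomorphisms X tri" for v \<sigma>
  proof -
    have "rows D' (F (push_coloring \<sigma> D v)) = rows D' (push_coloring \<sigma> D' (F v))"
      using f_endo[OF rows_D[OF v] \<sigma>] rows_F[OF v] rows_F[OF push_coloring_closed[OF D(1) \<sigma> v]]
      by (simp add: rows_push)
    then show ?thesis
      using bij' F_in[OF push_coloring_closed[OF D(1) \<sigma> v]] push_coloring_closed[OF D'(1) \<sigma> F_in[OF v]]
      by (metis bij_betw_imp_inj_on inj_onD)
  qed
  have value_eq: "cocycle_value \<phi> (coloring_vector X D' (F v)) = cocycle_value \<phi> (coloring_vector X D v)"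
    if "v \<in> colorings X tri D" "\<phi> \<in> C" for v \<phi>
    using cocycle_value_coloring_vector[OF D(1) that] cocycle_value_coloring_vector[OF D'(1) F_in[OF that(1)] that(2)]
      f_weight[OF rows_D[OF that(1)] that(2)] rows_F[OF that(1)] by simp
  let ?Q = "quiver_representation X tri C TYPE('k) S"
  show ?thesis
    unfolding quiver_isomorphic_def
  proof (intro exI[of _ F] exI[of _ "map_prod F id"] conjI ballI)
    show "bij_betw F (verts (?Q D)) (verts (?Q D'))"
      using F by (simp add: quiver_representation_def)
    show "bij_betw (map_prod F id) (arcs (?Q D)) (arcs (?Q D'))"
      using bij_betw_map_prod[OF F bij_betw_id[of S]] by (simp add: quiver_representation_def)
  next
    fix e assume "e \<in> arcs (?Q D)"
    then obtain v \<sigma> where e: "e = (v, \<sigma>)" "v \<in> colorings X tri D" "\<sigma> \<in> S"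
      by (auto simp: quiver_representation_def)
    have \<sigma>: "\<sigma> \<in> quandle_endomorphisms X tri" using S e(3) by blast
    show "tail (?Q D') (map_prod F id e) = F (tail (?Q D) e)"
      using e by (simp add: quiver_representation_def)
    show "head (?Q D') (map_prod F id e) = F (head (?Q D) e)"
      using e F_push[OF e(2) \<sigma>] by (simp add: quiver_representation_def)
    have "edge_map X C (coloring_vector X D' (F v)) \<sigma> = (edge_map X C (coloring_vector X D v) \<sigma> :: ('a \<Rightarrow>\<^sub>0 'k) \<Rightarrow> _)"
    proof (rule edge_map_cong)
      fix \<phi> assume "\<phi> \<in> C"
      then show "cocycle_value \<phi> (coloring_vector X D' (F v)) = cocycle_value \<phi> (coloring_vector X D v)"
        using value_eq e(2) by blast
      show "cocycle_value \<phi> (endo_chain X \<sigma> (coloring_vector X D' (F v))) =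
          cocycle_value \<phi> (endo_chain X \<sigma> (coloring_vector X D v))"
        unfolding endo_chain_coloring_vector[OF D(1) \<sigma>] endo_chain_coloring_vector[OF D'(1) \<sigma>]
          F_push[OF e(2) \<sigma>, symmetric]
        using value_eq[OF push_coloring_closed[OF D(1) \<sigma> e(2)] \<open>\<phi> \<in> C\<close>] .
    qed
    then show "edge_weight (?Q D') (map_prod F id e) = edge_weight (?Q D) e"
      using e by (simp add: quiver_representation_def)
  next
    fix v assume "v \<in> verts (?Q D)"
    then have "v \<in> colorings X tri D" by (simp add: quiver_representation_def)
    then have "vertex_module C (coloring_vector X D' (F v)) = (vertex_module C (coloring_vector X D v) :: ('a \<Rightarrow>\<^sub>0 'k) set)"
      by (intro vertex_module_cong value_eq)
    then show "vertex_weight (?Q D') (F v) = vertex_weight (?Q D) v"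
      by (simp add: quiver_representation_def)
  qed
qed

lemma quiver_isomorphic_virtual_move:
  assumes "S \<subseteq> quandle_endomorphisms X tri" and "virtual_move D D'"
  shows "quiver_isomorphic (quiver_representation X tri C TYPE('k::ring_1) S D)
           (quiver_representation X tri C TYPE('k) S D')"
proof -
  obtain B A l r T T' where D: "link_diagram D" "D = B @ map (pad l r) T @ A"
    and D': "link_diagram D'" "D' = B @ map (pad l r) T' @ A"
    and "(planar_isotopy T T' \<or> classical_reidemeister T T' \<or> virtual_reidemeister T T') \<or>
         (planar_isotopy T' T \<or> classical_reidemeister T' T \<or> virtual_reidemeister T' T)"
    using assms(2) unfolding virtual_move_def local_move_def by blast
  then have "local_equiv T T'"
    using local_equiv_move local_equiv_sym by blast
  from quiver_isomorphic_local_equiv[OF assms(1) local_equiv_pad[OF this] D D'] show ?thesis .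
qed

end

lemma quiver_isomorphic_refl: "quiver_isomorphic G G"
  unfolding quiver_isomorphic_def by (intro exI[of _ id]) auto

lemma quiver_isomorphic_trans:
  assumes "quiver_isomorphic G H" "quiver_isomorphic H I"
  shows "quiver_isomorphic G I"
proof -
  obtain f g where f: "bij_betw f (verts G) (verts H)" "bij_betw g (arcs G) (arcs H)"
    "\<And>e. e \<in> arcs G \<Longrightarrow> tail H (g e) = f (tail G e) \<and> head H (g e) = f (head G e)"
    "\<And>v. v \<in> verts G \<Longrightarrow> vertex_weight H (f v) = vertex_weight G v"
    "\<And>e. e \<in> arcs G \<Longrightarrow> edge_weight H (g e) = edge_weight G e"
    using assms(1) unfolding quiver_isomorphic_def by blast
  obtain f' g' where f': "bij_betw f' (verts H) (verts I)" "bij_betw g' (arcs H) (arcs I)"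
    "\<And>e. e \<in> arcs H \<Longrightarrow> tail I (g' e) = f' (tail H e) \<and> head I (g' e) = f' (head H e)"
    "\<And>v. v \<in> verts H \<Longrightarrow> vertex_weight I (f' v) = vertex_weight H v"
    "\<And>e. e \<in> arcs H \<Longrightarrow> edge_weight I (g' e) = edge_weight H e"
    using assms(2) unfolding quiver_isomorphic_def by blast
  show ?thesis
    unfolding quiver_isomorphic_def
    by (intro exI[of _ "f' \<circ> f"] exI[of _ "g' \<circ> g"] conjI ballI)
       (use f f' bij_betw_apply[OF f(1)] bij_betw_apply[OF f(2)] in \<open>auto intro: bij_betw_trans\<close>)
qed

lemma classical_move_imp_virtual_move: "classical_move D D' \<Longrightarrow> virtual_move D D'"
  unfolding classical_move_def virtual_move_def classical_diagram_def local_move_def by blast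

theorem proposition3:
  fixes X :: "'x set" and tri :: "'x \<Rightarrow> 'x \<Rightarrow> 'x"
    and C :: "('x \<times> 'x \<Rightarrow> 'a::ab_group_add) set"
    and S :: "('x \<Rightarrow> 'x) set"
  assumes "finite X" and "quandle X tri"
    and "finite C" and "C \<subseteq> quandle_2cocycles X tri"
    and "S \<subseteq> quandle_endomorphisms X tri"
  shows "(\<forall>D D'. virtual_move D D' \<longrightarrow>
            quiver_isomorphic (quiver_representation X tri C TYPE('k::ring_1) S D)
                              (quiver_representation X tri C TYPE('k) S D'))
       \<and> (\<forall>D D'. same_virtual_link D D' \<longrightarrow>
            quiver_isomorphic (quiver_representation X tri C TYPE('k) S D)
                              (quiver_representation X tri C TYPE('k) S D'))
       \<and> (\<forall>D D'. same_classical_link D D' \<longrightarrow>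
            quiver_isomorphic (quiver_representation X tri C TYPE('k) S D)
                              (quiver_representation X tri C TYPE('k) S D'))"
proof -
  interpret quandle_with_cocycles X tri C
    using assms by unfold_locales
  let ?Q = "quiver_representation X tri C TYPE('k) S"
  have move: "quiver_isomorphic (?Q D) (?Q D')" if "virtual_move D D'" for D D'
    using quiver_isomorphic_virtual_move[OF assms(5) that] .
  have virtual: "quiver_isomorphic (?Q D) (?Q D')" if "virtual_move\<^sup>*\<^sup>* D D'" for D D'
    using that
    by induction (auto intro: quiver_isomorphic_refl quiver_isomorphic_trans move)
  have classical: "quiver_isomorphic (?Q D) (?Q D')" if "classical_move\<^sup>*\<^sup>* D D'" for D D'
    using virtual[OF rtranclp_mono[THEN predicate2D, OF _ that]] classical_move_imp_virtual_move by blast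
  show ?thesis
    using move virtual classical unfolding same_virtual_link_def same_classical_link_def by blast
qed

end
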